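(* Let $W$ be an irreducible $T$-submodule of $V$ and let $r$ be its endpoint. Then the sequence $(A;\{E_i\}_{i=r}^{N-r};A^*;\{E^*_i\}_{i=r}^{N-r})$ acts on $W$ as a Leonard system $\Phi$, and $\Phi$ has dual $q$-Krawtchouk type with parameters \[ d(\Phi)=N-2r,\quad h(\Phi)=\frac{\varphi q^{N-r}}{q-1},\quad h^*(\Phi)=q^{-r},\quad s(\Phi)=-\varphi^{-1}q^{2r-N-1},\quad \theta_0(\Phi)=\frac{\varphi q^{N-r}-q^r}{q-1},\quad \theta^*_0(\Phi)=q^{-r}. \]
   Context: Let $q$ be a prime power, $GF(q)$ the field with $q$ elements, $N\ge 1$ an integer, and $\mathbf V$ an $N$-dimensional vector space over $GF(q)$. Let $X$ be the set of all subspaces of $\mathbf V$, ordered by inclusion (the projective geometry $L_N(q)$). For $y,z\in X$, $y$ covers $z$ means $z\subseteq y$ and $\dim y-\dim z=1$. ${\rm Mat}_X(\mathbb C)$ is the algebra of complex matrices with rows and columns indexed by $X$; it acts on $V=\mathbb C^X$ by left multiplication. $A^*\in{\rm Mat}_X(\mathbb C)$ is the diagonal matrix with $(y,y)$-entry $q^{-\dim y}$. For $0\le i\le N$, $E^*_i$ is the diagonal matrix with $(y,y)$-entry $1$ if $\dim y=i$ and $0$ otherwise. Fix a real number $\varphi>0$. The matrix $A\in{\rm Mat}_X(\mathbb C)$ has $(y,z)$-entry $1$ if $y$ covers $z$; $\varphi q^{\dim y}$ if $z$ covers $y$; $\frac{\varphi-1}{q-1}q^{\dim y}$ if $y=z$;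 and $0$ otherwise. It is a fact that $A$ is diagonalizable with the mutually distinct eigenvalues $\theta_i=\frac{\varphi q^{N-i}-q^i}{q-1}$ $(0\le i\le N)$; $E_i$ acts as the identity on the $\theta_i$-eigenspace of $A$ and as $0$ on the other eigenspaces. $T$ is the subalgebra of ${\rm Mat}_X(\mathbb C)$ generated by $A,A^*$. A $T$-module is irreducible if it is nonzero and has no $T$-submodules other than $0$ and itself. The endpoint of an irreducible $T$-submodule $W$ of $V$ is $\min\{i: 0\le i\le N,\ E^*_iW\ne0\}$. It is known that the endpoint $r$ satisfies $0\le r\le N/2$. Leonard systems: let $W$ be a complex vector space of dimension $d+1\ge1$. A linear map on $W$ is multiplicity-free if $W$ is spanned by its eigenspaces and each has dimension one. A Leonard system (of diameter $d$) on $W$ is a sequence $(B;\{F_i\}_{i=0}^d;B^*;\{F^*_i\}_{i=0}^d)$ such that $B,B^*$ are multiplicity-free linear maps on $W$; $\{F_i\}_{i=0}^d$ (resp. $\{F_i^*\}_{i=0}^d$) is an ordering of the primitive idempotents (projections onto the eigenspaces along the sum of the others) of $B$ (resp. $B^*$); and for $0\le i,j\le d$, each of $F^*_iBF^*_j$ and $F_iB^*F_j$ is zero if $|i-j|>1$ and nonzero if $|i-j|=1$. In the claim, $d=N-2r$ and $F_i,F^*_i$ are the restrictions of $E_{r+i},E^*_{r+i}$ to $W$. Parameter array: for a Leonard system $\Phi=(B;\{F_i\}_{i=0}^d;B^*;\{F^*_i\}_{i=0}^d)$ of diameter $d$ on a complex vector space $W$ of dimension $d+1$, $\theta_i(\Phi)$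 (resp. $\theta^*_i(\Phi)$) is the eigenvalue of $B$ (resp. $B^*$) for $F_i$ (resp. $F^*_i$). It is known there are unique nonzero scalars $\varphi_i(\Phi)$ $(1\le i\le d)$ for which there is a basis $w_0,\dots,w_d$ of $W$ with $Bw_i=\theta_i(\Phi)w_i+w_{i+1}$ ($w_{d+1}=0$), $B^*w_i=\theta^*_i(\Phi)w_i+\varphi_i(\Phi)w_{i-1}$ ($w_{-1}=0$); and unique nonzero scalars $\phi_i(\Phi)$ $(1\le i\le d)$ for which there is a basis with the same property with $\theta_i(\Phi)$ replaced by $\theta_{d-i}(\Phi)$ and $\varphi_i(\Phi)$ by $\phi_i(\Phi)$. (The scalars $\varphi_i(\Phi)$ are not to be confused with the fixed parameter $\varphi$.) $\Phi$ has dual $q$-Krawtchouk type with parameters $d,h,h^*,s,\theta_0,\theta^*_0$ ($h,h^*,s$ nonzero) if it has diameter $d$ and \[ \theta_i(\Phi)=\theta_0+h(1-q^i)(1-sq^{i+1})q^{-i},\qquad \theta^*_i(\Phi)=\theta^*_0+h^*(1-q^i)q^{-i}\qquad(0\le i\le d), \] \[ \varphi_i(\Phi)=hh^*q^{1-2i}(1-q^i)(1-q^{i-d-1}),\qquad \phi_i(\Phi)=hh^*s\,q^{d+2-2i}(1-q^i)(1-q^{i-d-1})\qquad(1\le i\le d). \] *)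

theory Defs
  imports "HOL-Analysis.Analysis"
begin

section \<open>Leonard systems\<close>

text \<open>
  A finite-dimensional complex vector space is given as a subspace \<open>W\<close> of some
  \<open>complex ^ 'x\<close>; a linear map on \<open>W\<close> is a function whose values outside \<open>W\<close> are irrelevant.
\<close>

definition linear_map_on :: "(complex ^ 'x) set \<Rightarrow> (complex ^ 'x \<Rightarrow> complex ^ 'x) \<Rightarrow> bool" where
  "linear_map_on W B \<longleftrightarrow>
     (\<forall>u\<in>W. B u \<in> W) \<and>
     (\<forall>u\<in>W. \<forall>v\<in>W. B (u + v) = B u + B v) \<and>
     (\<forall>c. \<forall>u\<in>W. B (c *s u) = c *s B u)"

definition eigenspace_on ::
    "(complex ^ 'x) set \<Rightarrow> (complex ^ 'x \<Rightarrow> complex ^ 'x) \<Rightarrow> complex \<Rightarrow> (complex ^ 'x) set" where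
  "eigenspace_on W B \<mu> = {w \<in> W. B w = \<mu> *s w}"

definition eigenvalues_on ::
    "(complex ^ 'x) set \<Rightarrow> (complex ^ 'x \<Rightarrow> complex ^ 'x) \<Rightarrow> complex set" where
  "eigenvalues_on W B = {\<mu>. eigenspace_on W B \<mu> \<noteq> {0}}"

definition multiplicity_free_on ::
    "(complex ^ 'x) set \<Rightarrow> (complex ^ 'x \<Rightarrow> complex ^ 'x) \<Rightarrow> bool" where
  "multiplicity_free_on W B \<longleftrightarrow>
     linear_map_on W B \<and>
     vec.span (\<Union>\<mu>\<in>eigenvalues_on W B. eigenspace_on W B \<mu>) = W \<and>
     (\<forall>\<mu>\<in>eigenvalues_on W B. vec.dim (eigenspace_on W B \<mu>) = 1)"

text \<open>
  \<open>P\<close> is the projection of \<open>W\<close> onto the \<open>\<mu>\<close>-eigenspace of \<open>B\<close> along the sum of the other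
  eigenspaces.
\<close>

definition primitive_idempotent_on ::
    "(complex ^ 'x) set \<Rightarrow> (complex ^ 'x \<Rightarrow> complex ^ 'x) \<Rightarrow> complex \<Rightarrow>
     (complex ^ 'x \<Rightarrow> complex ^ 'x) \<Rightarrow> bool" where
  "primitive_idempotent_on W B \<mu> P \<longleftrightarrow>
     \<mu> \<in> eigenvalues_on W B \<and> linear_map_on W P \<and>
     (\<forall>\<nu>. \<forall>w\<in>eigenspace_on W B \<nu>. P w = (if \<nu> = \<mu> then w else 0))"

definition idempotent_ordering_on ::
    "(complex ^ 'x) set \<Rightarrow> nat \<Rightarrow> (complex ^ 'x \<Rightarrow> complex ^ 'x) \<Rightarrow>
     (nat \<Rightarrow> complex ^ 'x \<Rightarrow> complex ^ 'x) \<Rightarrow> bool" where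
  "idempotent_ordering_on W d B F \<longleftrightarrow>
     (\<exists>\<theta>. bij_betw \<theta> {0..d} (eigenvalues_on W B) \<and>
          (\<forall>i\<le>d. primitive_idempotent_on W B (\<theta> i) (F i)))"

record 'x leonard_data =
  lspace :: "(complex ^ 'x) set"
  diam :: nat
  opr :: "complex ^ 'x \<Rightarrow> complex ^ 'x"
  idems :: "nat \<Rightarrow> complex ^ 'x \<Rightarrow> complex ^ 'x"
  dual_opr :: "complex ^ 'x \<Rightarrow> complex ^ 'x"
  dual_idems :: "nat \<Rightarrow> complex ^ 'x \<Rightarrow> complex ^ 'x"

definition zero_on :: "(complex ^ 'x) set \<Rightarrow> (complex ^ 'x \<Rightarrow> complex ^ 'x) \<Rightarrow> bool" where
  "zero_on W B \<longleftrightarrow> (\<forall>w\<in>W. B w = 0)"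

definition tridiagonal_on ::
    "(complex ^ 'x) set \<Rightarrow> nat \<Rightarrow> (nat \<Rightarrow> complex ^ 'x \<Rightarrow> complex ^ 'x) \<Rightarrow>
     (complex ^ 'x \<Rightarrow> complex ^ 'x) \<Rightarrow> bool" where
  "tridiagonal_on W d F B \<longleftrightarrow>
     (\<forall>i\<le>d. \<forall>j\<le>d.
        (\<bar>int i - int j\<bar> > 1 \<longrightarrow> zero_on W (F i \<circ> B \<circ> F j)) \<and>
        (\<bar>int i - int j\<bar> = 1 \<longrightarrow> \<not> zero_on W (F i \<circ> B \<circ> F j)))"

definition leonard_system :: "'x::finite leonard_data \<Rightarrow> bool" where
  "leonard_system \<Phi> \<longleftrightarrow>
     vec.subspace (lspace \<Phi>) \<and> vec.dim (lspace \<Phi>) = diam \<Phi> + 1 \<and>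
     multiplicity_free_on (lspace \<Phi>) (opr \<Phi>) \<and>
     multiplicity_free_on (lspace \<Phi>) (dual_opr \<Phi>) \<and>
     idempotent_ordering_on (lspace \<Phi>) (diam \<Phi>) (opr \<Phi>) (idems \<Phi>) \<and>
     idempotent_ordering_on (lspace \<Phi>) (diam \<Phi>) (dual_opr \<Phi>) (dual_idems \<Phi>) \<and>
     tridiagonal_on (lspace \<Phi>) (diam \<Phi>) (dual_idems \<Phi>) (opr \<Phi>) \<and>
     tridiagonal_on (lspace \<Phi>) (diam \<Phi>) (idems \<Phi>) (dual_opr \<Phi>)"


section \<open>Parameter arrays\<close>

definition eigenvalue_seq :: "'x::finite leonard_data \<Rightarrow> nat \<Rightarrow> complex" where
  "eigenvalue_seq \<Phi> i = (THE \<mu>. primitive_idempotent_on (lspace \<Phi>) (opr \<Phi>) \<mu> (idems \<Phi> i))"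

definition dual_eigenvalue_seq :: "'x::finite leonard_data \<Rightarrow> nat \<Rightarrow> complex" where
  "dual_eigenvalue_seq \<Phi> i =
     (THE \<mu>. primitive_idempotent_on (lspace \<Phi>) (dual_opr \<Phi>) \<mu> (dual_idems \<Phi> i))"

text \<open>
  The scalars \<open>f 1, \<dots>, f d\<close> are nonzero, and \<open>w 0, \<dots>, w d\<close> is a basis of the space with
  \<open>B w\<^sub>i = \<theta>\<^sub>i w\<^sub>i + w\<^sub>i\<^sub>+\<^sub>1\<close> and \<open>B\<^sup>* w\<^sub>i = \<theta>\<^sup>*\<^sub>i w\<^sub>i + f\<^sub>i w\<^sub>i\<^sub>-\<^sub>1\<close>, for a given ordering
  \<open>\<theta>\<close> of the eigenvalues of \<open>B\<close>.
\<close>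

definition split_scalars ::
    "'x::finite leonard_data \<Rightarrow> (nat \<Rightarrow> complex) \<Rightarrow> (nat \<Rightarrow> complex) \<Rightarrow> bool" where
  "split_scalars \<Phi> \<theta> f \<longleftrightarrow>
     (\<forall>i\<in>{1..diam \<Phi>}. f i \<noteq> 0) \<and>
     (\<exists>w :: nat \<Rightarrow> complex ^ 'x.
        inj_on w {0..diam \<Phi>} \<and> vec.independent (w ` {0..diam \<Phi>}) \<and>
        vec.span (w ` {0..diam \<Phi>}) = lspace \<Phi> \<and>
        (\<forall>i\<le>diam \<Phi>.
           opr \<Phi> (w i) = \<theta> i *s w i + (if i < diam \<Phi> then w (i + 1) else 0) \<and>
           dual_opr \<Phi> (w i) =
             dual_eigenvalue_seq \<Phi> i *s w i + (if 0 < i then f i *s w (i - 1) else 0)))"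

definition first_split_seq :: "'x::finite leonard_data \<Rightarrow> nat \<Rightarrow> complex" where
  "first_split_seq \<Phi> i = (THE c. \<exists>f. split_scalars \<Phi> (eigenvalue_seq \<Phi>) f \<and> f i = c)"

definition second_split_seq :: "'x::finite leonard_data \<Rightarrow> nat \<Rightarrow> complex" where
  "second_split_seq \<Phi> i =
     (THE c. \<exists>f. split_scalars \<Phi> (\<lambda>j. eigenvalue_seq \<Phi> (diam \<Phi> - j)) f \<and> f i = c)"

definition dual_q_Krawtchouk_type ::
    "complex \<Rightarrow> 'x::finite leonard_data \<Rightarrow> nat \<Rightarrow> complex \<Rightarrow> complex \<Rightarrow> complex \<Rightarrow> complex \<Rightarrow> complex \<Rightarrow> bool"
    where
  "dual_q_Krawtchouk_type q \<Phi> d h h' s \<theta>0 \<theta>0' \<longleftrightarrow>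
     h \<noteq> 0 \<and> h' \<noteq> 0 \<and> s \<noteq> 0 \<and> diam \<Phi> = d \<and>
     (\<forall>i\<le>d.
        eigenvalue_seq \<Phi> i =
          \<theta>0 + h * (1 - q ^ i) * (1 - s * q ^ (i + 1)) * q powi (- int i) \<and>
        dual_eigenvalue_seq \<Phi> i = \<theta>0' + h' * (1 - q ^ i) * q powi (- int i)) \<and>
     (\<forall>i\<in>{1..d}.
        first_split_seq \<Phi> i =
          h * h' * q powi (1 - 2 * int i) * (1 - q ^ i) * (1 - q powi (int i - int d - 1)) \<and>
        second_split_seq \<Phi> i =
          h * h' * s * q powi (int d + 2 - 2 * int i) * (1 - q ^ i) *
            (1 - q powi (int i - int d - 1)))"


section \<open>The matrices of the projective geometry\<close>

text \<open>
  The vector space over \<open>GF(q)\<close> has scalar multiplication \<open>smul\<close>, with \<open>q = CARD('f)\<close>.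
  So that the library matrices \<open>complex ^ 'x ^ 'x\<close> can be used, the set \<open>X\<close> of its subspaces
  is indexed by a finite type: \<open>sub\<close> is meant to be a bijection from \<open>'x\<close> onto \<open>X\<close>.
\<close>

definition sub_dim ::
    "('f::field \<Rightarrow> 'v::ab_group_add \<Rightarrow> 'v) \<Rightarrow> ('x \<Rightarrow> 'v set) \<Rightarrow> 'x \<Rightarrow> nat" where
  "sub_dim smul sub y = vector_space.dim smul (sub y)"

definition covers ::
    "('f::field \<Rightarrow> 'v::ab_group_add \<Rightarrow> 'v) \<Rightarrow> ('x \<Rightarrow> 'v set) \<Rightarrow> 'x \<Rightarrow> 'x \<Rightarrow> bool" where
  "covers smul sub y z \<longleftrightarrow> sub z \<subseteq> sub y \<and> sub_dim smul sub y = sub_dim smul sub z + 1"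

definition A_dual ::
    "('f::{field,finite} \<Rightarrow> 'v::ab_group_add \<Rightarrow> 'v) \<Rightarrow> ('x \<Rightarrow> 'v set) \<Rightarrow> complex ^ 'x ^ 'x" where
  "A_dual smul sub =
     (\<chi> y z. if y = z then of_nat CARD('f) powi (- int (sub_dim smul sub y)) else 0)"

definition E_dual ::
    "('f::field \<Rightarrow> 'v::ab_group_add \<Rightarrow> 'v) \<Rightarrow> ('x \<Rightarrow> 'v set) \<Rightarrow> nat \<Rightarrow> complex ^ 'x ^ 'x" where
  "E_dual smul sub i = (\<chi> y z. if y = z \<and> sub_dim smul sub y = i then 1 else 0)"

definition A_mat ::
    "('f::{field,finite} \<Rightarrow> 'v::ab_group_add \<Rightarrow> 'v) \<Rightarrow> ('x \<Rightarrow> 'v set) \<Rightarrow> real \<Rightarrow>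
     complex ^ 'x ^ 'x" where
  "A_mat smul sub \<phi> =
     (let q = of_nat CARD('f) in
      \<chi> y z. if covers smul sub y z then 1
             else if covers smul sub z y then of_real \<phi> * q ^ sub_dim smul sub y
             else if y = z then (of_real \<phi> - 1) / (q - 1) * q ^ sub_dim smul sub y
             else 0)"

definition A_eigenvalue :: "complex \<Rightarrow> nat \<Rightarrow> real \<Rightarrow> nat \<Rightarrow> complex" where
  "A_eigenvalue q N \<phi> i = (of_real \<phi> * q ^ (N - i) - q ^ i) / (q - 1)"

text \<open>
  The matrix acting as the identity on one eigenspace and as zero on all the others; it is
  well defined because \<open>A_mat\<close> is diagonalizable.
\<close>

definition E_mat ::
    "('f::{field,finite} \<Rightarrow> 'v::ab_group_add \<Rightarrow> 'v) \<Rightarrow> ('x::finite \<Rightarrow> 'v set) \<Rightarrow> nat \<Rightarrow> real \<Rightarrow>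
     nat \<Rightarrow> complex ^ 'x ^ 'x" where
  "E_mat smul sub N \<phi> i =
     (THE M. \<forall>\<mu> v. A_mat smul sub \<phi> *v v = \<mu> *s v \<longrightarrow>
        M *v v = (if \<mu> = A_eigenvalue (of_nat CARD('f)) N \<phi> i then v else 0))"


section \<open>The algebra and its modules\<close>

text \<open>The unital subalgebra generated by \<open>S\<close>; \<open>mat c\<close> is the scalar matrix \<open>c I\<close>.\<close>

inductive_set gen_algebra :: "(complex ^ 'x ^ 'x) set \<Rightarrow> (complex ^ 'x ^ 'x) set"
  for S :: "(complex ^ 'x::finite ^ 'x) set" where
  gen: "M \<in> S \<Longrightarrow> M \<in> gen_algebra S"
| scalar: "mat c \<in> gen_algebra S"
| add: "M \<in> gen_algebra S \<Longrightarrow> M' \<in> gen_algebra S \<Longrightarrow> M + M' \<in> gen_algebra S"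
| mult: "M \<in> gen_algebra S \<Longrightarrow> M' \<in> gen_algebra S \<Longrightarrow> M ** M' \<in> gen_algebra S"

definition T_algebra ::
    "('f::{field,finite} \<Rightarrow> 'v::ab_group_add \<Rightarrow> 'v) \<Rightarrow> ('x::finite \<Rightarrow> 'v set) \<Rightarrow> real \<Rightarrow>
     (complex ^ 'x ^ 'x) set" where
  "T_algebra smul sub \<phi> = gen_algebra {A_mat smul sub \<phi>, A_dual smul sub}"

definition submodule :: "(complex ^ 'x ^ 'x) set \<Rightarrow> (complex ^ 'x) set \<Rightarrow> bool" where
  "submodule T W \<longleftrightarrow> vec.subspace W \<and> (\<forall>M\<in>T. \<forall>w\<in>W. M *v w \<in> W)"

definition irreducible_submodule :: "(complex ^ 'x ^ 'x) set \<Rightarrow> (complex ^ 'x) set \<Rightarrow> bool" where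
  "irreducible_submodule T W \<longleftrightarrow>
     submodule T W \<and> W \<noteq> {0} \<and> (\<forall>U. submodule T U \<and> U \<subseteq> W \<longrightarrow> U = {0} \<or> U = W)"

definition endpoint ::
    "('f::field \<Rightarrow> 'v::ab_group_add \<Rightarrow> 'v) \<Rightarrow> ('x::finite \<Rightarrow> 'v set) \<Rightarrow> nat \<Rightarrow>
     (complex ^ 'x) set \<Rightarrow> nat" where
  "endpoint smul sub N W = Min {i \<in> {0..N}. (\<lambda>w. E_dual smul sub i *v w) ` W \<noteq> {0}}"

end

theory Submission
  imports Defs
begin

text \<open>
  Let \<open>R\<close> and \<open>L\<close> be the raising and lowering maps of the subspace lattice. Counting subspaces shows
  that \<open>L R - R L\<close> is the scalar \<open>(q^(N-i) - q^i)/(q - 1)\<close> on level \<open>i\<close>. A vector \<open>w\<close> of level \<open>r\<close>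
  killed by \<open>L\<close> therefore generates the module spanned by \<open>R^j w\<close>, and the scalars by which \<open>L\<close> lowers
  this string force it to end exactly at \<open>j = N - 2 r\<close>; an irreducible module with endpoint \<open>r\<close> is such
  a string. On it \<open>A\<close> is tridiagonal and \<open>A\<^sup>*\<close> diagonal, and two explicit triangular changes of
  basis bring the pair into the two split forms, from which the parameter array is read off.

  A split form shows that \<open>A\<^sup>*\<close> maps the sum of the eigenspaces of \<open>A\<close> with index at least \<open>j\<close> into
  the one with index at least \<open>j - 1\<close>; the two forms together make \<open>A\<^sup>*\<close> tridiagonal with respect
  to the eigenspaces of \<open>A\<close>, and irreducibility keeps the off-diagonal blocks from vanishing. That
  \<open>A\<close> is diagonalizable on the whole space follows since \<open>R\<close> and \<open>L\<close> are adjoint, so the whole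
  space is the sum of the range of \<open>R\<close> and the kernel of \<open>L\<close>, hence the sum of all such strings.
\<close>

subsection \<open>Counting subspaces over a finite field\<close>

locale finite_field_vector_space = finite_dimensional_vector_space scale Basis
  for scale :: "'a::{field,finite} \<Rightarrow> 'b::ab_group_add \<Rightarrow> 'b" and Basis :: "'b set"
begin

lemma dim_eq_Suc_if_between:
  assumes "subspace Y" "subspace S" "Y \<subseteq> S" "S \<noteq> Y" "S \<subseteq> Z" "dim Z = Suc (dim Y)"
  shows "dim S = Suc (dim Y)"
proof -
  have "dim Y < dim S"
    using subspace_dim_equal[OF assms(1,2,3)] assms(4) by force
  moreover have "dim S \<le> dim Z" using assms(5) by (rule dim_subset)
  ultimately show ?thesis using assms(6) by linarith
qed


abbreviation subspace_sum :: "'b set \<Rightarrow> 'b set \<Rightarrow> 'b set" where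
  "subspace_sum S T \<equiv> {x + y |x y. x \<in> S \<and> y \<in> T}"

lemma subspace_sum_upper1: "subspace T \<Longrightarrow> S \<subseteq> subspace_sum S T"
  using subspace_0 add_0_right by force

lemma subspace_sum_upper2: "subspace S \<Longrightarrow> T \<subseteq> subspace_sum S T"
  using subspace_0 add_0_left by force

lemma subspace_sum_least: "subspace Z \<Longrightarrow> S \<subseteq> Z \<Longrightarrow> T \<subseteq> Z \<Longrightarrow> subspace_sum S T \<subseteq> Z"
  using subspace_add by blast

text \<open>The sum of \<open>Y\<close> and \<open>Y'\<close> lies between \<open>Y\<close> and
  \<open>Z\<close> and differs from \<open>Y\<close>, so its dimension is \<open>dim Y + 1\<close>;
  the dimension formula for sums and intersections gives the rest.\<close>

lemma dim_Int_if_common_cover: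
  assumes "subspace Y" "subspace Y'" "subspace Z" "Y \<noteq> Y'" "Y \<subseteq> Z" "Y' \<subseteq> Z"
    and "dim Y' = dim Y" "dim Z = Suc (dim Y)"
  shows "Suc (dim (Y \<inter> Y')) = dim Y"
proof -
  let ?S = "subspace_sum Y Y'"
  have "?S \<noteq> Y"
  proof
    assume "?S = Y"
    then have "Y' \<subseteq> Y" using subspace_sum_upper2[OF assms(1), of Y'] by simp
    then have "Y' = Y" using subspace_dim_equal[OF assms(2,1)] assms(7) by simp
    then show False using assms(4) by simp
  qed
  then have "dim ?S = Suc (dim Y)"
    using dim_eq_Suc_if_between[OF assms(1) subspace_sums[OF assms(1,2)] subspace_sum_upper1[OF assms(2)]]
      subspace_sum_least[OF assms(3,5,6)] assms(8) by blast
  then show ?thesis using dim_sums_Int[OF assms(1,2)] assms(7) by linarith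
qed

section \<open>Number of vectors in a subspace\<close>

definition q :: nat where "q = CARD('a)"

lemma q_ge_2: "q \<ge> 2"
proof -
  have "card {0, 1::'a} \<le> CARD('a)" by (rule card_mono) auto
  then show ?thesis by (simp add: q_def)
qed

text \<open>The parametrization by pairs lets the vectors be counted in the next lemma, where
  independence makes it injective.\<close>

lemma span_insert_eq_image:
  "span (insert b B) = (\<lambda>(k, x). scale k b + x) ` (UNIV \<times> span B)" (is "_ = ?R")
proof (intro equalityI subsetI)
  fix x assume "x \<in> span (insert b B)"
  then obtain k where "x - scale k b \<in> span B" unfolding span_insert by blast
  then show "x \<in> ?R" by (intro image_eqI[where x = "(k, x - scale k b)"]) auto
next
  fix x assume "x \<in> ?R"
  then obtain k y where "x = scale k b + y" "y \<in> span B" by auto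
  then have "x - scale k b \<in> span B" by simp
  then show "x \<in> span (insert b B)" unfolding span_insert by blast
qed

lemma card_span:
  assumes "finite B" "independent B"
  shows "finite (span B) \<and> card (span B) = q ^ card B"
  using assms
proof (induction B rule: finite_induct)
  case empty
  then show ?case by simp
next
  case (insert b B)
  then have b: "b \<notin> span B" and ind: "independent B"
    by (auto simp: independent_insert split: if_splits)
  have "inj_on (\<lambda>(k, x). scale k b + x) (UNIV \<times> span B)"
  proof (rule inj_onI, clarify)
    fix k x k' x'
    assume x: "x \<in> span B" "x' \<in> span B" and eq: "scale k b + x = scale k' b + x'"
    have "scale (k - k') b = x' - x" using eq by (simp add: algebra_simps)
    then have *: "scale (k - k') b \<in> span B" using x by (simp add: span_diff)
    have "k = k'"
    proof (rule ccontr)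
      assume "k \<noteq> k'"
      then have "scale (inverse (k - k')) (scale (k - k') b) = b" by simp
      then show False using b span_scale[OF *] by metis
    qed
    then show "k = k' \<and> x = x'" using eq by simp
  qed
  then have "card (span (insert b B)) = CARD('a) * card (span B)"
    unfolding span_insert_eq_image by (simp add: card_image card_cartesian_product)
  then show ?case using insert ind by (simp add: span_insert_eq_image q_def)
qed

lemma card_subspace:
  assumes "subspace S"
  shows "finite S \<and> card S = q ^ dim S"
  using card_span basis_subspace_exists[OF assms] by metis

lemma finite_vectors: "finite (UNIV :: 'b set)"
  using card_subspace[OF subspace_UNIV] by simp

text \<open>For a subspace \<open>M\<close> inside \<open>Z\<close> these correspond to the
  one-dimensional subspaces of the quotient Z/M.\<close>

definition covers_between :: "'b set \<Rightarrow> 'b set \<Rightarrow> 'b set set" where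
  "covers_between M Z = {Y. subspace Y \<and> M \<subseteq> Y \<and> Y \<subseteq> Z \<and> dim Y = Suc (dim M)}"

definition hyperplanes :: "'b set \<Rightarrow> 'b set set" where
  "hyperplanes Z = {H. subspace H \<and> H \<subseteq> Z \<and> Suc (dim H) = dim Z}"

lemma finite_set_of_subspaces: "finite (\<A> :: 'b set set)"
  using finite_subset[OF subset_UNIV, of \<A>] finite_vectors by (simp add: Finite_Set.finite_set)

text \<open>A cover is recovered from any one of its vectors outside \<open>M\<close>, so distinct
  covers share no such vector. This makes the partition in the next count disjoint.\<close>

lemma covers_between_eq_span:
  assumes "subspace M" "Y \<in> covers_between M Z" "v \<in> Y - M"
  shows "Y = span (insert v M)"
proof -
  have "dim (span (insert v M)) = Suc (dim M)"
    using assms by (simp add: dim_insert span_eq_iff[THEN iffD2])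
  moreover have "span (insert v M) \<subseteq> Y"
    using assms by (intro span_minimal) (auto simp: covers_between_def)
  ultimately show ?thesis
    using subspace_dim_equal[of "span (insert v M)" Y] assms by (auto simp: covers_between_def)
qed

text \<open>The sets \<open>Y - M\<close> partition \<open>Z - M\<close>, and each has
  \<open>q ^ Suc (dim M) - q ^ dim M\<close> elements. Multiplying by \<open>q - 1\<close> instead
  of dividing keeps the count in the naturals.\<close>

lemma card_covers_between:
  assumes "subspace M" "subspace Z" "M \<subseteq> Z"
  shows "card (covers_between M Z) * (q - 1) = q ^ (dim Z - dim M) - 1"
proof -
  let ?C = "covers_between M Z" and ?m = "dim M"
  have le: "?m \<le> dim Z" using assms(3) by (rule dim_subset)
  have "Z - M = (\<Union>Y\<in>?C. Y - M)"
  proof (intro equalityI subsetI)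
    fix v assume v: "v \<in> Z - M"
    have "dim (span (insert v M)) = Suc ?m"
      using v assms by (simp add: dim_insert span_eq_iff[THEN iffD2])
    then have "span (insert v M) \<in> ?C"
      using v assms span_superset[of "insert v M"] span_minimal[of "insert v M" Z]
      by (auto simp: covers_between_def)
    then show "v \<in> (\<Union>Y\<in>?C. Y - M)" using v span_base[of v "insert v M"] by blast
  qed (auto simp: covers_between_def)
  moreover have "card (\<Union>Y\<in>?C. Y - M) = (\<Sum>Y\<in>?C. card (Y - M))"
  proof (rule card_UN_disjoint; (intro ballI impI)?)
    fix Y Y' assume "Y \<in> ?C" "Y' \<in> ?C" "Y \<noteq> Y'"
    then show "(Y - M) \<inter> (Y' - M) = {}"
      using covers_between_eq_span[OF assms(1), of _ Z] by (metis Diff_Int2 disjoint_iff)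
  qed (simp_all add: finite_set_of_subspaces finite_subset[OF subset_UNIV finite_vectors])
  moreover have "card (Y - M) = q ^ Suc ?m - q ^ ?m" if "Y \<in> ?C" for Y
    using that card_subspace[of Y] card_subspace[OF assms(1)]
    by (subst card_Diff_subset) (auto simp: covers_between_def)
  moreover have "card (Z - M) = q ^ dim Z - q ^ ?m"
    using card_subspace[OF assms(2)] card_subspace[OF assms(1)] assms(3)
    by (subst card_Diff_subset) auto
  ultimately have "q ^ dim Z - q ^ ?m = card ?C * (q ^ Suc ?m - q ^ ?m)" by simp
  moreover have "q ^ dim Z - q ^ ?m = q ^ ?m * (q ^ (dim Z - ?m) - 1)"
    using le by (simp add: right_diff_distrib' flip: power_add)
  moreover have "q ^ Suc ?m - q ^ ?m = q ^ ?m * (q - 1)"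
    by (simp add: diff_mult_distrib2 mult.commute[of q])
  ultimately have "q ^ ?m * (q ^ (dim Z - ?m) - 1) = q ^ ?m * (card ?C * (q - 1))"
    by (metis mult.left_commute)
  then show ?thesis using q_ge_2 by auto
qed

text \<open>
  Fix a hyperplane \<open>Z'\<close> of \<open>Z\<close>. Every other hyperplane \<open>H\<close> covers the hyperplane \<open>H \<inter> Z'\<close> of \<open>Z'\<close>,
  and each hyperplane of \<open>Z'\<close> arises from exactly \<open>q\<close> of them.
\<close>

lemma card_hyperplanes:
  assumes "subspace Z"
  shows "card (hyperplanes Z) * (q - 1) = q ^ dim Z - 1"
  using assms
proof (induction "dim Z" arbitrary: Z)
  case 0
  then have "hyperplanes Z = {}" unfolding hyperplanes_def by (simp del: dim_eq_0)
  then show ?case by (simp flip: 0(1))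
next
  case (Suc n)
  have "n \<le> dim Z" using Suc(2) by simp
  then obtain Z' where Z': "subspace Z'" "Z' \<subseteq> span Z" "dim Z' = n"
    by (rule choose_subspace_of_subspace)
  then have sub: "Z' \<subseteq> Z" using span_eq_iff Suc(3) by blast
  note Z' = Z'(1) sub Z'(3)
  have Int: "H \<inter> Z' \<in> hyperplanes Z'" if "H \<in> hyperplanes Z" "H \<noteq> Z'" for H
    using dim_Int_if_common_cover[of H Z' Z] that Z' Suc(2,3)
    by (auto simp: hyperplanes_def subspace_inter)
  \<comment> \<open>This yields disjointness: a hyperplane of \<open>Z\<close> other than
    \<open>Z'\<close> determines the \<open>M\<close> that it covers.\<close>
  have Int_eq: "H \<inter> Z' = M"
    if M: "M \<in> hyperplanes Z'" and H: "H \<in> covers_between M Z" "H \<noteq> Z'" for M H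
  proof -
    have "H \<in> hyperplanes Z" using M H Z' Suc(2) by (auto simp: hyperplanes_def covers_between_def)
    then have "H \<inter> Z' \<in> hyperplanes Z'" using Int H(2) by blast
    then have "dim (H \<inter> Z') \<le> dim M" "subspace (H \<inter> Z')"
      using M by (auto simp: hyperplanes_def)
    moreover have "subspace M" "M \<subseteq> H \<inter> Z'"
      using M H by (auto simp: hyperplanes_def covers_between_def)
    ultimately show ?thesis using subspace_dim_equal by metis
  qed
  have "hyperplanes Z - {Z'} = (\<Union>M\<in>hyperplanes Z'. covers_between M Z - {Z'})"
  proof (intro equalityI subsetI)
    fix H assume H: "H \<in> hyperplanes Z - {Z'}"
    then have "H \<in> covers_between (H \<inter> Z') Z"
      using Int[of H] Z' Suc(2) by (auto simp: hyperplanes_def covers_between_def)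
    then show "H \<in> (\<Union>M\<in>hyperplanes Z'. covers_between M Z - {Z'})"
      using Int[of H] H by blast
  next
    fix H assume "H \<in> (\<Union>M\<in>hyperplanes Z'. covers_between M Z - {Z'})"
    then obtain M where "M \<in> hyperplanes Z'" "H \<in> covers_between M Z" "H \<noteq> Z'" by blast
    then show "H \<in> hyperplanes Z - {Z'}"
      using Z'(3) Suc(2) by (simp add: hyperplanes_def covers_between_def)
  qed
  moreover have "card (\<Union>M\<in>hyperplanes Z'. covers_between M Z - {Z'}) =
      (\<Sum>M\<in>hyperplanes Z'. card (covers_between M Z - {Z'}))"
  proof (rule card_UN_disjoint; (intro ballI impI)?)
    fix M M' assume M: "M \<in> hyperplanes Z'" "M' \<in> hyperplanes Z'" "M \<noteq> M'"
    show "(covers_between M Z - {Z'}) \<inter> (covers_between M' Z - {Z'}) = {}"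
    proof (rule ccontr)
      assume "\<not> ?thesis"
      then obtain H where "H \<in> covers_between M Z" "H \<in> covers_between M' Z" "H \<noteq> Z'" by blast
      then show False using Int_eq[OF M(1)] Int_eq[OF M(2)] M(3) by metis
    qed
  qed (rule finite_set_of_subspaces)+
  \<comment> \<open>\<open>M\<close> has \<open>q + 1\<close> covers inside \<open>Z\<close>;
    removing \<open>Z'\<close> itself leaves \<open>q\<close>.\<close>
  moreover have "card (covers_between M Z - {Z'}) = q" if M: "M \<in> hyperplanes Z'" for M
  proof -
    have "dim Z - dim M = 2" "Z' \<in> covers_between M Z" "subspace M" "M \<subseteq> Z"
      using M Z' Suc(2) by (auto simp: hyperplanes_def covers_between_def)
    then have "card (covers_between M Z) * (q - 1) = q ^ 2 - 1"
      using card_covers_between[of M Z] Suc(3) by auto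
    also have "\<dots> = (q + 1) * (q - 1)" using q_ge_2 by (simp add: power2_eq_square algebra_simps)
    finally have "card (covers_between M Z) = q + 1"
      using q_ge_2 mult_right_cancel[of "q - 1" "card (covers_between M Z)" "q + 1"] by linarith
    then show ?thesis using \<open>Z' \<in> covers_between M Z\<close> by simp
  qed
  ultimately have "card (hyperplanes Z - {Z'}) = card (hyperplanes Z') * q" by simp
  moreover have "Z' \<in> hyperplanes Z" using Z' Suc(2) by (simp add: hyperplanes_def)
  \<comment> \<open>Adding \<open>Z'\<close> back gives the recursion h(n + 1) = 1 + q h(n), solved
    by a geometric sum.\<close>
  ultimately have "card (hyperplanes Z) = Suc (card (hyperplanes Z') * q)"
    using card.remove finite_set_of_subspaces by metis
  then have "card (hyperplanes Z) * (q - 1) = (q - 1) + q * (card (hyperplanes Z') * (q - 1))"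
    by (simp add: algebra_simps)
  also have "\<dots> = (q - 1) + q * (q ^ n - 1)" using Suc(1)[of Z'] Z' by simp
  also have "\<dots> = q ^ Suc n - 1"
    using q_ge_2 by (simp add: right_diff_distrib' Suc_leI)
  finally show ?case using Suc(2) by simp
qed

text \<open>Each side counts at most one subspace: a common cover must be the sum of
  \<open>Y\<close> and \<open>Z\<close>, a common hyperplane must be their intersection. By the
  dimension formula both occur exactly when the intersection has codimension one in
  \<open>Y\<close>.\<close>

lemma card_common_covers_eq:
  assumes "subspace Y" "subspace Z" "Y \<noteq> Z" "dim Y = dim Z"
  shows "card {U. subspace U \<and> Y \<subseteq> U \<and> Z \<subseteq> U \<and> dim U = Suc (dim Y)} =
    card {D. subspace D \<and> D \<subseteq> Y \<and> D \<subseteq> Z \<and> Suc (dim D) = dim Y}" (is "card ?U = card ?D")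
proof -
  let ?S = "subspace_sum Y Z"
  have S: "subspace ?S" "Y \<subseteq> ?S" "Z \<subseteq> ?S"
    using subspace_sums subspace_sum_upper1 subspace_sum_upper2 assms by auto
  have I: "subspace (Y \<inter> Z)" using assms subspace_inter by auto
  have sum: "dim ?S + dim (Y \<inter> Z) = 2 * dim Y"
    using dim_sums_Int[OF assms(1,2)] assms(4) by linarith
  have U: "U = ?S \<and> Suc (dim (Y \<inter> Z)) = dim Y" if "U \<in> ?U" for U
  proof -
    have "Suc (dim (Y \<inter> Z)) = dim Y" using dim_Int_if_common_cover[of Y Z U] assms that by auto
    moreover have "?S \<subseteq> U" using that by (intro subspace_sum_least) auto
    ultimately show ?thesis using subspace_dim_equal[OF S(1), of U] that sum by auto
  qed
  have D: "D = Y \<inter> Z \<and> Suc (dim (Y \<inter> Z)) = dim Y" if "D \<in> ?D" for D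
  proof -
    have "Y \<inter> Z \<noteq> Y" using assms subspace_dim_equal[OF assms(1,2)] by auto
    then have "dim (Y \<inter> Z) < dim Y"
      using subspace_dim_equal[OF I assms(1)] by force
    moreover have "D \<subseteq> Y \<inter> Z" "subspace D" using that by auto
    moreover from this have "dim D \<le> dim (Y \<inter> Z)" by (intro dim_subset)
    ultimately show ?thesis using that subspace_dim_equal[of D, OF _ I] by auto
  qed
  have U_mem: "?S \<in> ?U" and D_mem: "Y \<inter> Z \<in> ?D" if "Suc (dim (Y \<inter> Z)) = dim Y"
    using that S I sum by simp_all
  have card: "card \<A> = (if P then 1 else 0)"
    if "\<And>A. A \<in> \<A> \<Longrightarrow> A = B \<and> P" "P \<Longrightarrow> B \<in> \<A>" for \<A> B and P
  proof -
    have "\<A> = (if P then {B} else {})" using that by auto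
    then show ?thesis by simp
  qed
  show ?thesis
    using card[of ?U ?S "Suc (dim (Y \<inter> Z)) = dim Y", OF U U_mem]
      card[of ?D "Y \<inter> Z" "Suc (dim (Y \<inter> Z)) = dim Y", OF D D_mem] by (rule trans[OF _ sym])
qed

end

subsection \<open>Bases of eigenvectors\<close>

lemma mat_mult_vec: "mat c *v x = c *s (x :: complex ^ 'x::finite)"
  by (simp add: vec_eq_iff matrix_vector_mult_def mat_def if_distrib[where f = "\<lambda>a. a * _"] cong: if_cong)

lemma matrix_vector_span_subset:
  fixes P :: "complex ^ 'x::finite ^ 'x"
  assumes "\<And>x. x \<in> S \<Longrightarrow> P *v x \<in> U" "vec.subspace U" "x \<in> vec.span S"
  shows "P *v x \<in> U"
  using assms(3)
proof (rule vec.span_induct)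
  show "vec.subspace {x. P *v x \<in> U}"
    using assms(2) by (auto simp: vec.subspace_def vec.add vec.scale)
qed (use assms(1) in auto)

lemma matrix_vector_eq_on_span:
  fixes P Q :: "complex ^ 'x::finite ^ 'x"
  assumes "\<And>x. x \<in> S \<Longrightarrow> P *v x = Q *v x" "x \<in> vec.span S"
  shows "P *v x = Q *v x"
proof -
  have "(P - Q) *v x \<in> {0}"
    by (rule matrix_vector_span_subset[of S]) (use assms in \<open>auto simp: matrix_vector_mult_diff_rdistrib\<close>)
  then show ?thesis by (simp add: matrix_vector_mult_diff_rdistrib)
qed

text \<open>\<open>P\<close> is the product of the factors \<open>M - k\<close>; stating its effect
  on eigenvectors replaces the evaluation of polynomials at a matrix.\<close>

lemma gen_algebra_eigenpolynomial:
  fixes M :: "complex ^ 'x::finite ^ 'x"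
  assumes "M \<in> gen_algebra S" "finite K"
  shows "\<exists>P\<in>gen_algebra S. \<forall>\<mu> x. M *v x = \<mu> *s x \<longrightarrow> P *v x = (\<Prod>k\<in>K. \<mu> - k) *s x"
  using assms(2)
proof (induction K rule: finite_induct)
  case empty
  show ?case
    by (intro bexI[of _ "mat 1"]) (auto intro: gen_algebra.scalar simp: matrix_vector_mul_lid)
next
  case (insert k K)
  then obtain P where P: "P \<in> gen_algebra S"
    "\<And>\<mu> x. M *v x = \<mu> *s x \<Longrightarrow> P *v x = (\<Prod>k\<in>K. \<mu> - k) *s x" by blast
  have "((M + mat (- k)) ** P) *v x = (\<Prod>k\<in>insert k K. \<mu> - k) *s x" if "M *v x = \<mu> *s x" for \<mu> x
    using that P(2)[OF that] insert.hyps
    by (simp add: matrix_vector_mul_assoc[symmetric] matrix_vector_mult_add_rdistrib mat_mult_vec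
        vec.scale vector_smult_assoc vector_sadd_rdistrib[symmetric] algebra_simps)
  moreover have "(M + mat (- k)) ** P \<in> gen_algebra S"
    using assms(1) P(1) by (intro gen_algebra.mult gen_algebra.add gen_algebra.scalar)
  ultimately show ?case by blast
qed

text \<open>Lagrange interpolation: the product over \<open>K\<close> from the preceding lemma,
  divided by its value at \<nu>.\<close>

lemma gen_algebra_eigenprojector:
  fixes M :: "complex ^ 'x::finite ^ 'x"
  assumes "M \<in> gen_algebra S" "finite K" "\<nu> \<notin> K"
  shows "\<exists>P\<in>gen_algebra S. \<forall>\<mu> x. M *v x = \<mu> *s x \<and> \<mu> \<in> insert \<nu> K \<longrightarrow> P *v x = (if \<mu> = \<nu> then x else 0)"
proof -
  obtain P where P: "P \<in> gen_algebra S"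
    "\<And>\<mu> x. M *v x = \<mu> *s x \<Longrightarrow> P *v x = (\<Prod>k\<in>K. \<mu> - k) *s x"
    using gen_algebra_eigenpolynomial[OF assms(1,2)] by blast
  let ?c = "\<Prod>k\<in>K. \<nu> - k"
  have c: "?c \<noteq> 0" using assms by auto
  have "(mat (1 / ?c) ** P) *v x = (if \<mu> = \<nu> then x else 0)"
    if x: "M *v x = \<mu> *s x" and mu: "\<mu> \<in> insert \<nu> K" for \<mu> x
  proof (cases "\<mu> = \<nu>")
    case True
    then show ?thesis using P(2)[OF x] c
      by (simp add: matrix_vector_mul_assoc[symmetric] mat_mult_vec vector_smult_assoc)
  next
    case False
    then have "(\<Prod>k\<in>K. \<mu> - k) = 0" using mu assms(2) by (auto simp: prod_zero_iff)
    then show ?thesis using P(2)[OF x] False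
      by (simp add: matrix_vector_mul_assoc[symmetric] mat_mult_vec)
  qed
  moreover have "mat (1 / ?c) ** P \<in> gen_algebra S" using P(1) by (intro gen_algebra.mult gen_algebra.add gen_algebra.scalar)
  ultimately show ?thesis by blast
qed

lemma submodule_gen_algebra_iff:
  "submodule (gen_algebra S) U \<longleftrightarrow> vec.subspace U \<and> (\<forall>M\<in>S. \<forall>u\<in>U. M *v u \<in> U)"
proof (intro iffI)
  assume U: "vec.subspace U \<and> (\<forall>M\<in>S. \<forall>u\<in>U. M *v u \<in> U)"
  have "\<forall>u\<in>U. P *v u \<in> U" if "P \<in> gen_algebra S" for P
    using that
  proof induction
    case (scalar c)
    then show ?case using U by (simp add: mat_mult_vec vec.subspace_scale)
  next
    case (add M M')
    then show ?case using U by (simp add: matrix_vector_mult_add_rdistrib vec.subspace_add)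
  next
    case (mult M M')
    then show ?case by (simp add: matrix_vector_mul_assoc[symmetric])
  qed (use U in blast)
  then show "submodule (gen_algebra S) U" using U by (simp add: submodule_def)
qed (auto simp: submodule_def intro: gen_algebra.gen)

section \<open>A matrix with distinct eigenvalues on the span of its eigenvectors\<close>

locale eigenbasis =
  fixes M :: "complex ^ 'x::finite ^ 'x" and v :: "nat \<Rightarrow> complex ^ 'x" and \<theta> :: "nat \<Rightarrow> complex" and d :: nat
  assumes v_nonzero: "i \<le> d \<Longrightarrow> v i \<noteq> 0"
    and eigen: "i \<le> d \<Longrightarrow> M *v v i = \<theta> i *s v i"
    and inj_eigenvalues: "inj_on \<theta> {0..d}"
begin

abbreviation W where "W \<equiv> vec.span (v ` {0..d})"

lemma projector:
  assumes "M \<in> gen_algebra S" "i \<le> d"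
  shows "\<exists>P\<in>gen_algebra S. \<forall>k\<le>d. P *v v k = (if k = i then v k else 0)"
proof -
  have "\<theta> i \<notin> \<theta> ` ({0..d} - {i})" using inj_eigenvalues assms(2) by (auto dest: inj_onD)
  then obtain P where P: "P \<in> gen_algebra S" "\<And>\<mu> x. M *v x = \<mu> *s x \<Longrightarrow> \<mu> \<in> insert (\<theta> i) (\<theta> ` ({0..d} - {i})) \<Longrightarrow>
      P *v x = (if \<mu> = \<theta> i then x else 0)"
    using gen_algebra_eigenprojector[OF assms(1), of "\<theta> ` ({0..d} - {i})" "\<theta> i"] by blast
  have "P *v v k = (if k = i then v k else 0)" if "k \<le> d" for k
    using P(2)[OF eigen[OF that]] that assms(2) inj_onD[OF inj_eigenvalues, of k i] by auto
  with P(1) show ?thesis by blast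
qed

text \<open>The projector for index \<open>i\<close> annihilates the span of the other vectors but
  fixes \<open>v i\<close>, which is nonzero. Linear independence thus comes from the distinct
  eigenvalues.\<close>

lemma not_in_span_others:
  assumes "i \<le> d" "I \<subseteq> {0..d}" "i \<notin> I"
  shows "v i \<notin> vec.span (v ` I)"
proof
  assume v: "v i \<in> vec.span (v ` I)"
  obtain P where P: "\<And>k. k \<le> d \<Longrightarrow> P *v v k = (if k = i then v k else 0)"
    using projector[OF gen_algebra.gen, of "{M}" i] assms by auto
  have "P *v v k = 0" if "k \<in> I" for k using P[of k] that assms(2,3) by auto
  then have "P *v v i \<in> {0}"
    by - (rule matrix_vector_span_subset[of "v ` I"], use v in auto)
  then show False using P[OF assms(1)] v_nonzero[OF assms(1)] by simp
qed

lemma inj_v: "inj_on v {0..d}"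
proof (rule inj_onI)
  fix i j assume ij: "i \<in> {0..d}" "j \<in> {0..d}" "v i = v j"
  then show "i = j" using not_in_span_others[of i "{j}"] vec.span_base[of "v i" "{v j}"] by auto
qed

lemma independent_subset: "I \<subseteq> {0..d} \<Longrightarrow> vec.independent (v ` I)"
proof (induction I rule: infinite_finite_induct)
  case (infinite I)
  then show ?case using finite_subset[of I "{0..d}"] by simp
next
  case (insert i I)
  then show ?case using not_in_span_others[of i I] by (auto simp: vec.independent_insert)
qed (simp add: vec.dependent_def)

lemma independent_v: "vec.independent (v ` {0..d})"
  by (rule independent_subset) simp

lemma dim_W: "vec.dim W = d + 1"
  using vec.dim_span_eq_card_independent[OF independent_v] card_image[OF inj_v] by simp

lemma v_in_W: "i \<le> d \<Longrightarrow> v i \<in> W"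
  by (intro vec.span_base) auto

lemma M_W: "w \<in> W \<Longrightarrow> M *v w \<in> W"
  by (rule matrix_vector_span_subset[of "v ` {0..d}"]) (auto simp: eigen vec.span_scale v_in_W)

text \<open>The product of all \<open>M - \<theta> k\<close> annihilates \<open>W\<close>, so \<mu>
  is one of the \<open>\<theta> i\<close>; the projector for this eigenvalue fixes \<open>w\<close>
  and maps \<open>W\<close> into the line of \<open>v i\<close>.\<close>

lemma eigenvector_in_W:
  assumes "w \<in> W" "w \<noteq> 0" "M *v w = \<mu> *s w"
  obtains i where "i \<le> d" "\<mu> = \<theta> i" "w \<in> vec.span {v i}"
proof -
  obtain P where P: "\<And>\<mu> x. M *v x = \<mu> *s x \<Longrightarrow> P *v x = (\<Prod>k\<in>\<theta> ` {0..d}. \<mu> - k) *s x"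
    using gen_algebra_eigenpolynomial[OF gen_algebra.gen, of M "{M}" "\<theta> ` {0..d}"] by blast
  have "P *v v k = 0" if "k \<le> d" for k
    using P[OF eigen[OF that]] that by (auto simp: prod_zero_iff)
  then have "P *v w \<in> {0}"
    by - (rule matrix_vector_span_subset[of "v ` {0..d}"], use assms(1) in auto)
  then obtain i where i: "i \<le> d" "\<mu> = \<theta> i"
    using P[OF assms(3)] assms(2) by auto
  have "\<theta> i \<notin> \<theta> ` ({0..d} - {i})" using inj_eigenvalues i by (auto dest: inj_onD)
  then obtain Q where Q: "\<And>\<mu> x. M *v x = \<mu> *s x \<Longrightarrow> \<mu> \<in> insert (\<theta> i) (\<theta> ` ({0..d} - {i})) \<Longrightarrow>
      Q *v x = (if \<mu> = \<theta> i then x else 0)"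
    using gen_algebra_eigenprojector[OF gen_algebra.gen, of M "{M}" "\<theta> ` ({0..d} - {i})" "\<theta> i"] by blast
  have "Q *v v k \<in> vec.span {v i}" if "k \<le> d" for k
  proof (cases "k = i")
    case True
    then show ?thesis using Q[OF eigen[OF that]] by (simp add: vec.span_base)
  next
    case False
    then have "\<theta> k \<noteq> \<theta> i" using inj_onD[OF inj_eigenvalues, of k i] that i by auto
    then show ?thesis using Q[OF eigen[OF that]] that False by (simp add: vec.span_zero)
  qed
  then have "Q *v w \<in> vec.span {v i}"
    by - (rule matrix_vector_span_subset[of "v ` {0..d}"], use assms(1) in auto)
  then show ?thesis using that[OF i] Q[OF assms(3)] i by simp
qed

lemma eigenspace_eq: "i \<le> d \<Longrightarrow> eigenspace_on W ((*v) M) (\<theta> i) = vec.span {v i}"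
proof (intro equalityI subsetI)
  fix w assume i: "i \<le> d" and w: "w \<in> eigenspace_on W ((*v) M) (\<theta> i)"
  show "w \<in> vec.span {v i}"
  proof (cases "w = 0")
    case False
    then obtain k where "k \<le> d" "\<theta> i = \<theta> k" "w \<in> vec.span {v k}"
      using eigenvector_in_W[of w "\<theta> i"] w by (auto simp: eigenspace_on_def)
    then show ?thesis using inj_onD[OF inj_eigenvalues, of i k] i by simp
  qed (simp add: vec.span_zero)
next
  fix w assume i: "i \<le> d" and w: "w \<in> vec.span {v i}"
  then obtain c where "w = c *s v i" by (auto simp: vec.span_singleton)
  then show "w \<in> eigenspace_on W ((*v) M) (\<theta> i)"
    using i by (simp add: eigenspace_on_def vec.scale eigen vec.span_scale v_in_W vector_smult_assoc mult.commute)
qed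

lemma eigenvalues_eq: "eigenvalues_on W ((*v) M) = \<theta> ` {0..d}"
proof (intro equalityI subsetI)
  fix \<mu> assume "\<mu> \<in> eigenvalues_on W ((*v) M)"
  moreover have "0 \<in> eigenspace_on W ((*v) M) \<mu>" by (simp add: eigenspace_on_def vec.span_zero)
  ultimately obtain w where "w \<in> W" "w \<noteq> 0" "M *v w = \<mu> *s w"
    by (auto simp: eigenvalues_on_def eigenspace_on_def)
  then show "\<mu> \<in> \<theta> ` {0..d}" using eigenvector_in_W by (metis atLeastAtMost_iff image_eqI le0)
next
  fix \<mu> assume "\<mu> \<in> \<theta> ` {0..d}"
  then obtain i where i: "i \<le> d" "\<mu> = \<theta> i" by auto
  then have "v i \<in> eigenspace_on W ((*v) M) \<mu>" by (simp add: eigenspace_eq vec.span_base)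
  then show "\<mu> \<in> eigenvalues_on W ((*v) M)" using v_nonzero[OF i(1)] unfolding eigenvalues_on_def by blast
qed

lemma bij_eigenvalues: "bij_betw \<theta> {0..d} (eigenvalues_on W ((*v) M))"
  by (simp add: eigenvalues_eq bij_betw_def inj_eigenvalues)

lemma linear_map_on_matrix: "(\<And>w. w \<in> U \<Longrightarrow> P *v w \<in> U) \<Longrightarrow> linear_map_on U ((*v) P)"
  by (simp add: linear_map_on_def vec.add vec.scale)

lemma multiplicity_free: "multiplicity_free_on W ((*v) M)"
  unfolding multiplicity_free_on_def
proof (intro conjI ballI)
  show "linear_map_on W ((*v) M)" using M_W by (rule linear_map_on_matrix)
  have "(\<Union>\<mu>\<in>eigenvalues_on W ((*v) M). eigenspace_on W ((*v) M) \<mu>) = (\<Union>i\<in>{0..d}. vec.span {v i})"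
    unfolding eigenvalues_eq by (simp add: eigenspace_eq)
  moreover have "vec.span (\<Union>i\<in>{0..d}. vec.span {v i}) = W"
  proof (rule vec.span_unique)
    show "(\<Union>i\<in>{0..d}. vec.span {v i}) \<subseteq> W" using vec.span_mono[of "{v _}" "v ` {0..d}"] by (intro UN_least) simp
    fix T' assume T': "(\<Union>i\<in>{0..d}. vec.span {v i}) \<subseteq> T'" "vec.subspace T'"
    have "v i \<in> T'" if "i \<in> {0..d}" for i
      using T'(1) that vec.span_base[of "v i" "{v i}"] by blast
    then show "W \<subseteq> T'" by (intro vec.span_minimal image_subsetI T'(2))
  qed simp
  ultimately show "vec.span (\<Union>\<mu>\<in>eigenvalues_on W ((*v) M). eigenspace_on W ((*v) M) \<mu>) = W" by simp
  fix \<mu> assume "\<mu> \<in> eigenvalues_on W ((*v) M)"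
  then obtain i where i: "i \<le> d" "\<mu> = \<theta> i" by (auto simp: eigenvalues_eq)
  then show "vec.dim (eigenspace_on W ((*v) M) \<mu>) = 1"
    using vec.dim_span[of "{v i}"] v_nonzero[of i] by (simp add: eigenspace_eq)
qed

text \<open>\<open>P\<close> is prescribed only on the \<open>v k\<close>, so matrices defined on
  the whole space can serve as idempotents of \<open>W\<close>.\<close>

lemma primitive_idempotent:
  assumes "i \<le> d" and P: "\<And>k. k \<le> d \<Longrightarrow> P *v v k = (if k = i then v k else 0)"
  shows "primitive_idempotent_on W ((*v) M) (\<theta> i) ((*v) P)"
  unfolding primitive_idempotent_on_def
proof (intro conjI allI ballI)
  show "\<theta> i \<in> eigenvalues_on W ((*v) M)" using assms(1) by (auto simp: eigenvalues_eq)
  have "P *v w \<in> W" if "w \<in> W" for w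
    by (rule matrix_vector_span_subset[OF _ _ that]) (auto simp: P v_in_W vec.span_zero)
  then show "linear_map_on W ((*v) P)" by (rule linear_map_on_matrix)
  fix \<nu> w assume w: "w \<in> eigenspace_on W ((*v) M) \<nu>"
  show "P *v w = (if \<nu> = \<theta> i then w else 0)"
  proof (cases "w = 0")
    case False
    then obtain k where k: "k \<le> d" "\<nu> = \<theta> k" "w \<in> vec.span {v k}"
      using eigenvector_in_W[of w \<nu>] w by (auto simp: eigenspace_on_def)
    then obtain c where "w = c *s v k" by (auto simp: vec.span_singleton)
    then have "P *v w = (if k = i then w else 0)" by (simp add: vec.scale P k)
    moreover have "\<nu> = \<theta> i \<longleftrightarrow> k = i" using inj_onD[OF inj_eigenvalues, of k i] k assms(1) by auto
    ultimately show ?thesis by simp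
  qed simp
qed

lemma the_eigenvalue:
  assumes "i \<le> d" and P: "\<And>k. k \<le> d \<Longrightarrow> P *v v k = (if k = i then v k else 0)"
  shows "(THE \<mu>. primitive_idempotent_on W ((*v) M) \<mu> ((*v) P)) = \<theta> i"
proof (rule the_equality)
  show "primitive_idempotent_on W ((*v) M) (\<theta> i) ((*v) P)" using assms by (rule primitive_idempotent)
  fix \<mu> assume \<mu>: "primitive_idempotent_on W ((*v) M) \<mu> ((*v) P)"
  have "v i \<in> eigenspace_on W ((*v) M) (\<theta> i)" using assms(1) by (simp add: eigenspace_eq vec.span_base)
  then have "P *v v i = (if \<theta> i = \<mu> then v i else 0)" using \<mu> by (simp add: primitive_idempotent_on_def)
  then show "\<mu> = \<theta> i" using P[OF assms(1)] v_nonzero[OF assms(1)] by (auto split: if_splits)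
qed

text \<open>The band condition is \<open>far\<close>; that the entries next to the diagonal are
  nonzero comes from irreducibility, since \<open>B\<close> can leave an initial or final segment of
  indices through only one adjacent pair.\<close>

lemma tridiagonal_if_irreducible:
  assumes irr: "irreducible_submodule (gen_algebra {M, B}) W"
    and P: "\<And>i k. i \<le> d \<Longrightarrow> k \<le> d \<Longrightarrow> P i *v v k = (if k = i then v k else 0)"
    and far: "\<And>i j. i \<le> d \<Longrightarrow> j \<le> d \<Longrightarrow> \<bar>int i - int j\<bar> > 1 \<Longrightarrow> P i *v (B *v v j) = 0"
  shows "tridiagonal_on W d (\<lambda>i w. P i *v w) ((*v) B)"
proof -
  have B_W: "B *v w \<in> W" if "w \<in> W" for w
    using irr that by (auto simp: irreducible_submodule_def submodule_gen_algebra_iff)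
  have resolution: "(\<Sum>i\<le>d. P i) *v w = w" if "w \<in> W" for w
  proof -
    have "(\<Sum>i\<le>d. P i) *v v k = mat 1 *v v k" if "k \<le> d" for k
    proof -
      have "(\<Sum>i\<le>d. P i) *v v k = (\<Sum>i\<le>d. P i *v v k)"
        by (induction d) (simp_all add: matrix_vector_mult_add_rdistrib)
      also have "\<dots> = (\<Sum>i\<le>d. if k = i then v k else 0)" using P that by (intro sum.cong) auto
      also have "\<dots> = v k" using that by simp
      finally show ?thesis by simp
    qed
    then have "(\<Sum>i\<le>d. P i) *v w = mat 1 *v w"
      by - (rule matrix_vector_eq_on_span[of "v ` {0..d}"], use that in auto)
    then show ?thesis by simp
  qed
  have P_W: "P i *v w \<in> vec.span {v i}" if "w \<in> W" "i \<le> d" for i w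
    by (rule matrix_vector_span_subset[OF _ _ that(1)])
      (use that in \<open>auto simp: P vec.span_base vec.span_zero\<close>)
  text \<open>Otherwise the \<open>v k\<close> with \<open>k \<in> I\<close> would span a proper nonzero submodule.\<close>
  have link: "\<exists>k\<in>I. \<exists>i\<in>{0..d} - I. P i *v (B *v v k) \<noteq> 0"
    if I: "I \<subseteq> {0..d}" "I \<noteq> {}" "I \<noteq> {0..d}" for I
  proof (rule ccontr)
    assume "\<not> ?thesis"
    then have zero: "P i *v (B *v v k) = 0" if "k \<in> I" "i \<le> d" "i \<notin> I" for i k using that by auto
    let ?U = "vec.span (v ` I)"
    have "B *v v k \<in> ?U" if k: "k \<in> I" for k
    proof -
      have BW: "B *v v k \<in> W" using k I(1) by (intro B_W v_in_W) auto
      then have "B *v v k = (\<Sum>i\<le>d. P i) *v (B *v v k)" using resolution by simp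
      also have "\<dots> = (\<Sum>i\<le>d. P i *v (B *v v k))"
        by (induction d) (simp_all add: matrix_vector_mult_add_rdistrib)
      also have "\<dots> \<in> ?U"
      proof (rule vec.span_sum)
        fix i assume "i \<in> {..d}"
        then show "P i *v (B *v v k) \<in> ?U"
          using P_W[OF BW, of i] zero[OF k, of i] vec.span_mono[of "{v i}" "v ` I"]
          by (cases "i \<in> I") (auto simp: vec.span_zero)
      qed
      finally show ?thesis .
    qed
    then have "B *v u \<in> ?U" if "u \<in> ?U" for u
      by - (rule matrix_vector_span_subset[of "v ` I"], use that in auto)
    moreover have "M *v u \<in> ?U" if "u \<in> ?U" for u
      by (rule matrix_vector_span_subset[OF _ _ that]) (use I in \<open>auto simp: eigen vec.span_scale vec.span_base subset_eq\<close>)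
    ultimately have "submodule (gen_algebra {M, B}) ?U" by (simp add: submodule_gen_algebra_iff)
    moreover have "?U \<subseteq> W" using I by (intro vec.span_mono) auto
    ultimately have "?U = {0} \<or> ?U = W" using irr by (auto simp: irreducible_submodule_def)
    moreover obtain k where "k \<in> I" using I by blast
    then have "v k \<in> ?U" "v k \<noteq> 0" using I v_nonzero[of k] by (auto intro: vec.span_base)
    moreover have "\<not> {0..d} \<subseteq> I" using I(1,3) by blast
    then obtain i where "i \<le> d" "i \<notin> I" by (auto simp: subset_eq)
    then have "v i \<in> W" "v i \<notin> ?U" using v_in_W not_in_span_others I by auto
    ultimately show False by blast
  qed
  have nonzero: "P i *v (B *v v j) \<noteq> 0" if ij: "i \<le> d" "j \<le> d" "\<bar>int i - int j\<bar> = 1" for i j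
  proof -
    consider "i = Suc j" | "j = Suc i" using ij(3) by linarith
    then show ?thesis
    proof cases
      case 1
      \<comment> \<open>By \<open>far\<close>, the only way out of \<open>{0..j}\<close> is from
        \<open>j\<close> to \<open>Suc j\<close>; the final segment \<open>{j..d}\<close> serves the
        other case in the same way.\<close>
      obtain k l where kl: "k \<in> {0..j}" "l \<in> {0..d} - {0..j}" "P l *v (B *v v k) \<noteq> 0"
        using link[of "{0..j}"] 1 ij by force
      then have "\<not> \<bar>int l - int k\<bar> > 1" using far[of l k] ij by auto
      then have "k = j" "l = i" using kl 1 by auto
      then show ?thesis using kl by simp
    next
      case 2
      have "0 \<notin> {j..d}" "0 \<in> {0..d}" using 2 by auto
      then have "{j..d} \<noteq> {0..d}" by blast
      moreover have "{j..d} \<subseteq> {0..d}" "{j..d} \<noteq> {}" using ij by auto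
      ultimately have "\<exists>k\<in>{j..d}. \<exists>l\<in>{0..d} - {j..d}. P l *v (B *v v k) \<noteq> 0" by (intro link)
      then obtain k l where kl: "k \<in> {j..d}" "l \<in> {0..d} - {j..d}" "P l *v (B *v v k) \<noteq> 0" by blast
      then have "\<not> \<bar>int l - int k\<bar> > 1" using far[of l k] ij by auto
      then have "k = j" "l = i" using kl 2 by auto
      then show ?thesis using kl by simp
    qed
  qed
  show ?thesis
    unfolding tridiagonal_on_def zero_on_def
  proof (intro allI impI conjI)
    fix i j assume ij: "i \<le> d" "j \<le> d"
    {
      assume distant: "\<bar>int i - int j\<bar> > 1"
      have "(P i ** B ** P j) *v w \<in> {0}" if "w \<in> W" for w
        by (rule matrix_vector_span_subset[OF _ _ that]) (use far[OF ij distant] ij in \<open>auto simp: P matrix_vector_mul_assoc[symmetric]\<close>)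
      then show "\<forall>w\<in>W. ((*v) (P i) \<circ> (*v) B \<circ> (*v) (P j)) w = 0"
        by (simp add: matrix_vector_mul_assoc[symmetric])
    next
      assume "\<bar>int i - int j\<bar> = 1"
      then have "((*v) (P i) \<circ> (*v) B \<circ> (*v) (P j)) (v j) \<noteq> 0"
        using nonzero[OF ij] ij by (simp add: P)
      then show "\<not> (\<forall>w\<in>W. ((*v) (P i) \<circ> (*v) B \<circ> (*v) (P j)) w = 0)"
        using v_in_W[OF ij(2)] by blast
    }
  qed
qed

end

subsection \<open>Split forms\<close>

text \<open>One step of a triangular change of basis: \<open>a\<close> and \<open>b\<close> differ
  by a vector already spanned.\<close>

lemma span_insert_cong:
  fixes a b :: "complex ^ 'x::finite"
  assumes "vec.span S = vec.span T" "a - b \<in> vec.span T"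
  shows "vec.span (insert a S) = vec.span (insert b T)"
proof -
  have "x - k *s a \<in> vec.span T \<longleftrightarrow> x - k *s b \<in> vec.span T" for x k
  proof -
    have k: "k *s (a - b) \<in> vec.span T" using assms(2) by (rule vec.span_scale)
    have "x - k *s b = (x - k *s a) + k *s (a - b)" "x - k *s a = (x - k *s b) - k *s (a - b)"
      by (simp_all add: vec.scale_right_diff_distrib)
    then show ?thesis using vec.span_add[OF _ k] vec.span_diff[OF _ k] by metis
  qed
  then show ?thesis using assms(1) by (simp add: vec.span_insert)
qed

text \<open>The basis shape of \<open>split_scalars\<close>, together with distinctness of the
  \<theta>, which is what allows eigenvectors of \<open>A\<close> to be solved for.\<close>

locale split_form =
  fixes A B :: "complex ^ 'x::finite ^ 'x" and u :: "nat \<Rightarrow> complex ^ 'x"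
    and \<theta> \<tau> f :: "nat \<Rightarrow> complex" and d :: nat
  assumes inj_u: "inj_on u {0..d}"
    and independent_u: "vec.independent (u ` {0..d})"
    and A_u: "i \<le> d \<Longrightarrow> A *v u i = \<theta> i *s u i + (if i < d then u (i + 1) else 0)"
    and B_u: "i \<le> d \<Longrightarrow> B *v u i = \<tau> i *s u i + (if 0 < i then f i *s u (i - 1) else 0)"
    and inj_\<theta>: "inj_on \<theta> {0..d}"
begin

lemma u_nonzero: "i \<le> d \<Longrightarrow> u i \<noteq> 0"
  using independent_u vec.dependent_zero[of "u ` {0..d}"] by (metis atLeastAtMost_iff image_eqI le0)

text \<open>Coefficient of \<open>u i\<close> in the eigenvector for \<open>\<theta> j\<close> that
  has leading coefficient 1 at \<open>u j\<close>.\<close>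

definition t :: "nat \<Rightarrow> nat \<Rightarrow> complex" where
  "t j i = (\<Prod>k\<in>{j<..i}. 1 / (\<theta> j - \<theta> k))"

lemma t_Suc: "j \<le> i \<Longrightarrow> Suc i \<le> d \<Longrightarrow> t j (Suc i) * (\<theta> j - \<theta> (Suc i)) = t j i"
proof -
  assume ji: "j \<le> i" "Suc i \<le> d"
  then have "\<theta> j \<noteq> \<theta> (Suc i)" using inj_onD[OF inj_\<theta>, of j "Suc i"] by auto
  moreover have "{j<..Suc i} = insert (Suc i) {j<..i}" using ji by auto
  ultimately show ?thesis by (simp add: t_def)
qed

text \<open>Truncating the eigenvector at \<open>m\<close> leaves a defect only in the direction of
  \<open>u (m + 1)\<close>; at \<open>m = d\<close> it vanishes.\<close>

lemma eigenvector_partial_sum: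
  assumes "j \<le> m" "m \<le> d"
  shows "A *v (\<Sum>i=j..m. t j i *s u i) =
    \<theta> j *s (\<Sum>i=j..m. t j i *s u i) + t j m *s (if m < d then u (m + 1) else 0)"
  using assms
proof (induction m rule: dec_induct)
  case base
  then show ?case by (simp add: t_def A_u)
next
  case (step m)
  have "A *v (\<Sum>i=j..Suc m. t j i *s u i) =
      \<theta> j *s (\<Sum>i=j..m. t j i *s u i) + t j m *s u (Suc m) + t j (Suc m) *s (A *v u (Suc m))"
    using step by (simp add: vec.add vec.scale)
  also have "\<dots> = \<theta> j *s (\<Sum>i=j..m. t j i *s u i) + (t j m + t j (Suc m) * \<theta> (Suc m)) *s u (Suc m)
      + t j (Suc m) *s (if Suc m < d then u (Suc m + 1) else 0)"
    using step by (simp add: A_u vector_add_ldistrib vector_smult_assoc vector_sadd_rdistrib)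
  also have "t j m + t j (Suc m) * \<theta> (Suc m) = \<theta> j * t j (Suc m)"
    using t_Suc[of j m] step by (simp add: algebra_simps)
  finally show ?case using step by (simp add: vector_add_ldistrib vector_smult_assoc)
qed

definition v :: "nat \<Rightarrow> complex ^ 'x" where
  "v j = (\<Sum>i=j..d. t j i *s u i)"

lemma v_minus_u: "j \<le> d \<Longrightarrow> v j - u j \<in> vec.span (u ` {Suc j..d})"
proof -
  assume "j \<le> d"
  then have "v j - u j = (\<Sum>i=Suc j..d. t j i *s u i)"
    unfolding v_def by (subst sum.atLeast_Suc_atMost) (auto simp: t_def)
  also have "\<dots> \<in> vec.span (u ` {Suc j..d})"
    by (rule vec.span_sum) (intro vec.span_scale vec.span_base imageI)
  finally show ?thesis .
qed

text \<open>Going down from \<open>d\<close>, each \<open>v j\<close> is \<open>u j\<close> plus a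
  combination of later vectors.\<close>

lemma span_v_eq_span_u:
  assumes "j \<le> Suc d"
  shows "vec.span (v ` {j..d}) = vec.span (u ` {j..d})"
  using assms
proof (induction j rule: inc_induct)
  case (step n)
  then have "{n..d} = insert n {Suc n..d}" by auto
  then show ?case using span_insert_cong[OF step.IH v_minus_u[of n]] step by simp
qed simp

sublocale eigenbasis A v \<theta> d
proof
  fix i assume i: "i \<le> d"
  show "A *v v i = \<theta> i *s v i" using eigenvector_partial_sum[of i d] i by (simp add: v_def)
  show "v i \<noteq> 0"
  proof
    assume "v i = 0"
    then have "u i \<in> vec.span (u ` {Suc i..d})"
      using v_minus_u[OF i] vec.span_neg[of "- u i"] by simp
    moreover have "u ` {Suc i..d} \<subseteq> u ` {0..d} - {u i}"
    proof (rule image_subsetI)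
      fix k assume "k \<in> {Suc i..d}"
      then show "u k \<in> u ` {0..d} - {u i}" using inj_onD[OF inj_u, of k i] i by auto
    qed
    ultimately have "u i \<in> vec.span (u ` {0..d} - {u i})" using vec.span_mono by blast
    then show False using independent_u i unfolding vec.dependent_def by auto
  qed
qed (rule inj_\<theta>)

lemma W_eq: "W = vec.span (u ` {0..d})"
  using span_v_eq_span_u[of 0] by simp

text \<open>\<open>B\<close> lowers the index by at most one in the basis \<open>u\<close>, and the
  tails of \<open>u\<close> and \<open>v\<close> have the same spans, so the same bound holds for
  the eigenvectors.\<close>

lemma B_v: "j \<le> d \<Longrightarrow> B *v v j \<in> vec.span (v ` {j - 1..d})"
proof -
  assume j: "j \<le> d"
  have u: "u k \<in> vec.span (u ` {j - 1..d})" if "j - 1 \<le> k" "k \<le> d" for k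
    using that by (intro vec.span_base) auto
  have "v j \<in> vec.span (u ` {j..d})"
    using span_v_eq_span_u[of j] j vec.span_base[of "v j" "v ` {j..d}"] by simp
  moreover have "B *v u i \<in> vec.span (u ` {j - 1..d})" if "i \<in> {j..d}" for i
    using that u[of i] u[of "i - 1"] by (auto simp: B_u intro!: vec.span_add vec.span_scale)
  ultimately have "B *v v j \<in> vec.span (u ` {j - 1..d})"
    by - (rule matrix_vector_span_subset[of "u ` {j..d}"], auto)
  then show ?thesis using span_v_eq_span_u[of "j - 1"] j by simp
qed

lemma projector_B_v:
  assumes "\<And>k. k \<le> d \<Longrightarrow> P *v v k = (if k = i then v k else 0)" "i + 1 < j" "j \<le> d"
  shows "P *v (B *v v j) = 0"
proof -
  have "P *v (B *v v j) \<in> {0}"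
    by (rule matrix_vector_span_subset[OF _ _ B_v[OF assms(3)]]) (use assms in auto)
  then show ?thesis by simp
qed

end

text \<open>\<open>A\<close> generates the whole basis from its first vector, so \<open>u'\<close>
  is \<open>c\<close> times \<open>u\<close> throughout; comparing the actions of \<open>B\<close>
  yields the scalars.\<close>

lemma split_form_unique:
  assumes "split_form A B u \<theta> \<tau> f d" "split_form A B u' \<theta> \<tau> f' d"
    and u': "u' 0 = c *s u 0" and i: "i \<in> {1..d}"
  shows "f' i = f i"
proof -
  interpret s: split_form A B u \<theta> \<tau> f d by fact
  interpret s': split_form A B u' \<theta> \<tau> f' d by fact
  have c: "c \<noteq> 0" using s'.u_nonzero[of 0] u' by auto
  have eq: "u' k = c *s u k" if "k \<le> d" for k
    using that
  proof (induction k)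
    case (Suc k)
    have "\<theta> k *s u' k + u' (Suc k) = c *s (\<theta> k *s u k + u (Suc k))"
      using s.A_u[of k] s'.A_u[of k] Suc by (simp add: vec.scale)
    then show ?case using Suc by (simp add: vector_add_ldistrib vector_smult_assoc mult.commute)
  qed (rule u')
  have "\<tau> i *s u' i + f' i *s u' (i - 1) = c *s (\<tau> i *s u i + f i *s u (i - 1))"
    using s.B_u[of i] s'.B_u[of i] i eq[of i] by (simp add: vec.scale)
  moreover have "u' (i - 1) = c *s u (i - 1)" using eq i by auto
  ultimately have "(f' i * c) *s u (i - 1) = (c * f i) *s u (i - 1)"
    using eq[of i] i by (simp add: vector_add_ldistrib vector_smult_assoc mult.commute)
  moreover have "u (i - 1) \<noteq> 0" using i by (intro s.u_nonzero) auto
  ultimately show ?thesis using c by (auto simp: mult.commute)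
qed

subsection \<open>The coefficients of the two split forms\<close>

text \<open>
  In the application \<open>p = q^r\<close> and \<open>D = q^(N - 2 r)\<close>; the first split form arises for
  \<open>(\<alpha>, \<beta>) = (\<phi>, -1)\<close>, the second one for \<open>(-1, \<phi>)\<close>.
\<close>

locale split_coefficients =
  fixes q p D \<alpha> \<beta> :: complex
  assumes q_nonzero: "q \<noteq> 0" and q_power: "m > 0 \<Longrightarrow> q ^ m \<noteq> 1" and p_nonzero: "p \<noteq> 0"
begin

definition theta :: "nat \<Rightarrow> complex" where
  "theta i = (\<alpha> * p * D / q ^ i + \<beta> * p * q ^ i) / (q - 1)"

definition split :: "nat \<Rightarrow> complex" where
  "split i = \<alpha> / (q - 1) * (1 - q ^ i) * (q * D - q ^ i) / q ^ (2 * i)"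

text \<open>With \<open>tau\<close> as below this is \<open>split k / tau k\<close>.\<close>

definition psi :: "nat \<Rightarrow> complex" where
  "psi k = split k * p * q ^ k"

definition tau :: "nat \<Rightarrow> complex" where
  "tau i = 1 / (p * q ^ i)"

definition diag :: "nat \<Rightarrow> complex" where
  "diag j = (\<alpha> + \<beta>) / (q - 1) * p * q ^ j"

text \<open>The entry of \<open>A\<close> from \<open>w (j + 1)\<close> to \<open>w j\<close>.\<close>

definition super :: "nat \<Rightarrow> complex" where
  "super j = - \<alpha> * \<beta> * p ^ 2 * (q * q ^ j - 1) * (D - q ^ j) / (q - 1) ^ 2"

text \<open>Solution, with \<open>coef i i = 1\<close>, of the recursion that \<open>B\<close>
  imposes in \<open>coef_tau\<close>. The denominator is a q-factorial times a power of
  \<open>q - 1\<close>.\<close>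

definition coef :: "nat \<Rightarrow> nat \<Rightarrow> complex" where
  "coef i j = (if j \<le> i then (\<Prod>k\<in>{j<..i}. psi k) / (\<Prod>m\<in>{1..i - j}. q ^ m - 1) else 0)"

lemma coef_diag [simp]: "coef i i = 1" by (simp add: coef_def)
lemma coef_above [simp]: "i < j \<Longrightarrow> coef i j = 0" by (simp add: coef_def)

lemma coef_Suc_left: "j \<le> i \<Longrightarrow> coef (Suc i) j * (q ^ (Suc i - j) - 1) = psi (Suc i) * coef i j"
proof -
  assume j: "j \<le> i"
  then have "{j<..Suc i} = insert (Suc i) {j<..i}" by auto
  moreover have "{1..Suc i - j} = insert (Suc i - j) {1..i - j}" using j by auto
  ultimately show ?thesis using j q_power[of "Suc i - j"] by (simp add: coef_def Suc_diff_le)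
qed

lemma coef_Suc_right: "j < i \<Longrightarrow> coef i j * (q ^ (i - j) - 1) = psi (Suc j) * coef i (Suc j)"
proof -
  assume j: "j < i"
  then have "{j<..i} = insert (Suc j) {Suc j<..i}" by auto
  moreover obtain n where n: "i - j = Suc n" "i - Suc j = n" using j by (cases "i - j") auto
  moreover have "{1..Suc n} = insert (Suc n) {1..n}" by auto
  ultimately show ?thesis using j q_power[of "Suc n"] by (simp add: coef_def)
qed

lemma psi_Suc: "psi (Suc i) = \<alpha> * p / (q - 1) * (1 - q * q ^ i) * (D - q ^ i) / q ^ i"
proof -
  have "c * a * (q * b) / (q * s * (q * s)) * p * (q * s) = c * p * a * b / s" if "s \<noteq> 0" for a b c s
    using that q_nonzero by simp
  moreover have "q * D - q ^ Suc i = q * (D - q ^ i)" by (simp add: right_diff_distrib)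
  moreover have "q ^ (2 * Suc i) = q * q ^ i * (q * q ^ i)" by (simp add: mult_2 power_add)
  ultimately show ?thesis
    using q_nonzero unfolding psi_def split_def by (simp only: power_Suc) simp
qed

text \<open>In this form the term \<open>super j * coef i (Suc j)\<close> becomes a multiple of
  \<open>coef i j\<close> by \<open>coef_Suc_right\<close>.\<close>

lemma super_eq_psi: "super j = \<beta> * p * q ^ j / (q - 1) * psi (Suc j)"
proof -
  have "- \<alpha> * \<beta> * p ^ 2 * (- a) * b / c ^ 2 = \<beta> * p * t / c * (\<alpha> * p / c * a * b / t)"
    if "t \<noteq> 0" for a b c t
    using that by (simp add: power2_eq_square)
  from this[of "q ^ j" "1 - q * q ^ j" "D - q ^ j" "q - 1"] show ?thesis
    using q_nonzero by (simp add: super_def psi_Suc)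
qed

text \<open>\<open>tau j - tau i\<close> equals \<open>(q ^ (i - j) - 1) * tau i\<close>;
  \<open>coef_Suc_left\<close> absorbs the bracket, and \<open>psi i * tau i\<close> is
  \<open>split i\<close>.\<close>

lemma coef_tau:
  assumes "j < i"
  shows "(tau j - tau i) * coef i j = split i * coef (i - 1) j"
proof -
  obtain i' where i': "i = Suc i'" using assms by (cases i) auto
  have "q ^ i = q ^ j * q ^ (i - j)" using assms by (simp flip: power_add)
  then have "tau j - tau i = (q ^ (i - j) - 1) / (p * q ^ i)"
    using q_nonzero p_nonzero by (simp add: tau_def field_simps)
  then have "(tau j - tau i) * coef i j = psi i * coef (i - 1) j / (p * q ^ i)"
    using coef_Suc_left[of j i'] assms i' by (simp add: mult.commute)
  then show ?thesis using q_nonzero p_nonzero by (simp add: psi_def)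
qed

text \<open>The case \<open>j = 0\<close> fits in because \<open>psi 0 = 0\<close>.\<close>

lemma coef_theta:
  assumes "j \<le> i"
  shows "(if j = 0 then 0 else coef i (j - 1)) + diag j * coef i j + super j * coef i (Suc j) =
    theta i * coef i j + coef (Suc i) j"
proof -
  define t where "t = q ^ j"
  define s where "s = q ^ i"
  define x where "x = q ^ (i - j)"
  have t: "t \<noteq> 0" and s: "s = t * x" and x0: "x \<noteq> 0"
    using q_nonzero assms by (simp_all add: t_def s_def x_def flip: power_add)
  have x: "q * x \<noteq> 1" using q_power[of "Suc (i - j)"] by (simp add: x_def)
  \<comment> \<open>Facts 1 to 3 turn every neighbouring coefficient into a multiple of
    \<open>coef i j\<close>, so that one scalar identity remains.\<close>
  have 1: "(if j = 0 then 0 else coef i (j - 1)) = psi j * coef i j / (q * x - 1)"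
  proof (cases j)
    case 0
    then show ?thesis by (simp add: psi_def split_def)
  next
    case (Suc j')
    then have "i - j' = Suc (i - j)" using assms by simp
    then show ?thesis using coef_Suc_right[of j' i] Suc assms x by (simp add: x_def field_simps)
  qed
  have 2: "super j * coef i (Suc j) = \<beta> * p * t / (q - 1) * (x - 1) * coef i j"
  proof (cases "j = i")
    case False
    then show ?thesis using coef_Suc_right[of j i] assms by (simp add: super_eq_psi t_def x_def mult_ac)
  qed (simp add: x_def)
  have "Suc i - j = Suc (i - j)" using assms by simp
  then have 3: "coef (Suc i) j = psi (Suc i) * coef i j / (q * x - 1)"
    using coef_Suc_left[OF assms] x by (simp add: x_def field_simps)
  have psi_j: "psi j = \<alpha> * p / (q - 1) * (1 - t) * (q * D - t) / t"
  proof -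
    have "c * a * b / (t * t) * p * t = c * p * a * b / t" for a b c using t by simp
    from this[of "\<alpha> / (q - 1)" "1 - t" "q * D - t"] show ?thesis
      by (simp add: psi_def split_def t_def mult_2 power_add)
  qed
  have psi_i: "psi (Suc i) = \<alpha> * p / (q - 1) * (1 - q * s) * (D - s) / s"
    by (simp add: psi_Suc s_def)
  have "psi j / (q * x - 1) + diag j + \<beta> * p * t / (q - 1) * (x - 1) =
      theta i + psi (Suc i) / (q * x - 1)"
  proof -
    \<comment> \<open>The \<beta> terms add up to \<open>\<beta> * p * s / (q - 1)\<close> because
      \<open>s = t * x\<close>; what is left to check is this identity for the \<alpha>
      terms.\<close>
    have A: "(1 - t) * (q * D - t) / t / (q * x - 1) + t = D / s + (1 - q * s) * (D - s) / s / (q * x - 1)"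
    proof -
      have nz: "q * x - 1 \<noteq> 0" "s \<noteq> 0" using x s t x0 by auto
      have "((1 - t) * (q * D - t) / t / (q * x - 1) + t) * (s * (q * x - 1)) =
          (1 - t) * (q * D - t) * x + t * (s * (q * x - 1))"
        using nz t by (simp add: s field_simps)
      also have "\<dots> = D * (q * x - 1) + (1 - q * s) * (D - s)"
        unfolding s by (simp add: algebra_simps)
      also have "\<dots> = (D / s + (1 - q * s) * (D - s) / s / (q * x - 1)) * (s * (q * x - 1))"
        using nz by (simp add: field_simps)
      finally show ?thesis using nz by simp
    qed
    have "\<alpha> * p / (q - 1) * a * b / t / e + (\<alpha> + \<beta>) / (q - 1) * p * t + \<beta> * p * t / (q - 1) * (x - 1) =
        \<alpha> * p / (q - 1) * (a * b / t / e + t) + \<beta> * p * s / (q - 1)" for a b e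
      unfolding s by (simp add: add_divide_distrib diff_divide_distrib algebra_simps)
    from this[of "1 - t" "q * D - t" "q * x - 1"]
    have L: "psi j / (q * x - 1) + diag j + \<beta> * p * t / (q - 1) * (x - 1) =
        \<alpha> * p / (q - 1) * ((1 - t) * (q * D - t) / t / (q * x - 1) + t) + \<beta> * p * s / (q - 1)"
      unfolding psi_j diag_def t_def[symmetric] .
    have "\<alpha> * p / (q - 1) * (D / s + a * b / s / e) + \<beta> * p * s / (q - 1) =
        (\<alpha> * p * D / s + \<beta> * p * s) / (q - 1) + \<alpha> * p / (q - 1) * a * b / s / e" for a b e
      by (simp add: add_divide_distrib algebra_simps)
    from this[of "1 - q * s" "D - s" "q * x - 1"]
    have "\<alpha> * p / (q - 1) * ((1 - t) * (q * D - t) / t / (q * x - 1) + t) + \<beta> * p * s / (q - 1) =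
        theta i + psi (Suc i) / (q * x - 1)"
      unfolding A psi_i theta_def s_def[symmetric] .
    then show ?thesis by (rule trans[OF L])
  qed
  then have "(psi j / (q * x - 1) + diag j + \<beta> * p * t / (q - 1) * (x - 1)) * coef i j =
      (theta i + psi (Suc i) / (q * x - 1)) * coef i j" by simp
  then show ?thesis unfolding 1 2 3 by (simp add: distrib_right)
qed

section \<open>The triangular change of basis\<close>

definition split_vector :: "(nat \<Rightarrow> complex ^ 'x) \<Rightarrow> nat \<Rightarrow> complex ^ 'x" where
  "split_vector w i = (\<Sum>j\<le>i. coef i j *s w j)"

text \<open>After shifting indices, the coefficients of each \<open>w j\<close> are compared by
  \<open>coef_theta\<close>. The string is not cut off here; its end is dealt with in
  \<open>split_vector_end\<close>.\<close>

lemma split_vector_A: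
  fixes A :: "complex ^ 'x::finite ^ 'x"
  assumes A: "\<And>j. A *v w j = w (Suc j) + diag j *s w j + (if j = 0 then 0 else super (j - 1) *s w (j - 1))"
  shows "A *v split_vector w i = theta i *s split_vector w i + split_vector w (Suc i)"
proof -
  have "A *v split_vector w i = (\<Sum>j\<le>i. coef i j *s w (Suc j)) + (\<Sum>j\<le>i. (diag j * coef i j) *s w j)
      + (\<Sum>j\<le>i. if j = 0 then 0 else (coef i j * super (j - 1)) *s w (j - 1))"
    unfolding split_vector_def vec.sum vec.scale A sum.distrib[symmetric]
    by (intro sum.cong) (auto simp: vector_add_ldistrib vector_smult_assoc mult_ac)
  also have "(\<Sum>j\<le>i. coef i j *s w (Suc j)) = (\<Sum>j\<le>Suc i. (if j = 0 then 0 else coef i (j - 1)) *s w j)"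
    by (subst sum.atMost_Suc_shift) simp
  also have "\<dots> = (\<Sum>j\<le>i. (if j = 0 then 0 else coef i (j - 1)) *s w j) + w (Suc i)" by simp
  also have "(\<Sum>j\<le>i. if j = 0 then 0 else (coef i j * super (j - 1)) *s w (j - 1)) =
      (\<Sum>j\<le>Suc i. if j = 0 then 0 else (coef i j * super (j - 1)) *s w (j - 1))" by simp
  also have "\<dots> = (\<Sum>j\<le>i. (super j * coef i (Suc j)) *s w j)"
    by (subst sum.atMost_Suc_shift) (simp add: mult.commute)
  finally have "A *v split_vector w i = (\<Sum>j\<le>i. ((if j = 0 then 0 else coef i (j - 1)) +
      diag j * coef i j + super j * coef i (Suc j)) *s w j) + w (Suc i)"
    by (simp add: vector_sadd_rdistrib sum.distrib)
  also have "\<dots> = (\<Sum>j\<le>i. (theta i * coef i j + coef (Suc i) j) *s w j) + w (Suc i)"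
    using coef_theta by (intro arg_cong2[where f = plus] sum.cong) auto
  also have "\<dots> = theta i *s split_vector w i + split_vector w (Suc i)"
    by (simp add: split_vector_def vector_sadd_rdistrib sum.distrib vec.scale_sum_right vector_smult_assoc)
  finally show ?thesis .
qed

lemma split_vector_B:
  fixes B :: "complex ^ 'x::finite ^ 'x"
  assumes B: "\<And>j. B *v w j = tau j *s w j"
  shows "B *v split_vector w i =
    tau i *s split_vector w i + (if 0 < i then split i *s split_vector w (i - 1) else 0)"
proof -
  have "B *v split_vector w i - tau i *s split_vector w i = (\<Sum>j\<le>i. ((tau j - tau i) * coef i j) *s w j)"
    unfolding split_vector_def vec.sum vec.scale B vec.scale_sum_right sum_subtractf[symmetric]
    by (intro sum.cong) (auto simp: vector_smult_assoc vector_ssub_ldistrib algebra_simps vec.scale_left_diff_distrib)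
  also have "\<dots> = (\<Sum>j<i. ((tau j - tau i) * coef i j) *s w j)"
    by (simp add: lessThan_Suc_atMost[symmetric])
  also have "\<dots> = (\<Sum>j<i. (split i * coef (i - 1) j) *s w j)"
    by (intro sum.cong) (auto simp: coef_tau)
  also have "\<dots> = (if 0 < i then split i *s split_vector w (i - 1) else 0)"
    by (cases i) (auto simp: split_vector_def vec.scale_sum_right vector_smult_assoc lessThan_Suc_atMost)
  finally show ?thesis by (simp add: algebra_simps)
qed

lemma span_split_vector: "vec.span (split_vector w ` {0..d}) = vec.span (w ` {0..d})"
proof (induction d)
  case 0
  then show ?case by (simp add: split_vector_def)
next
  case (Suc d)
  have ins: "{0..Suc d} = insert (Suc d) {0..d}" by auto
  have "split_vector w (Suc d) - w (Suc d) = (\<Sum>j\<le>d. coef (Suc d) j *s w j)"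
    by (simp add: split_vector_def)
  also have "\<dots> \<in> vec.span (w ` {0..d})"
    by (rule vec.span_sum) (auto intro!: vec.span_scale[OF vec.span_base])
  finally show ?case unfolding ins image_insert by (rule span_insert_cong[OF Suc])
qed

end

subsection \<open>Raising and lowering maps\<close>

lemma basis_if_dim_span:
  fixes u :: "nat \<Rightarrow> complex ^ 'x::finite"
  assumes "vec.dim (vec.span (u ` {0..d})) = d + 1"
  shows "inj_on u {0..d}" "vec.independent (u ` {0..d})"
proof -
  have le: "card (u ` {0..d}) \<le> d + 1" using card_image_le[of "{0..d}" u] by simp
  have ge: "d + 1 \<le> card (u ` {0..d})"
    using vec.dim_le_card[of "vec.span (u ` {0..d})" "u ` {0..d}"] assms by simp
  show "inj_on u {0..d}" using le ge by (intro eq_card_imp_inj_on) auto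
  show "vec.independent (u ` {0..d})"
    by (rule vec.card_le_dim_spanning[of _ "vec.span (u ` {0..d})"]) (use assms le in \<open>auto intro: vec.span_base\<close>)
qed

text \<open>The eigenvalues are real and strictly decreasing in \<open>i\<close>: the first power
  falls, the second grows, and \<phi> is positive.\<close>

lemma inj_A_eigenvalue:
  assumes "q \<ge> 2" "\<phi> > 0"
  shows "inj_on (A_eigenvalue (of_nat q) N \<phi>) {0..N}"
proof (rule inj_onI)
  define f where "f i = (\<phi> * real q ^ (N - i) - real q ^ i) / (real q - 1)" for i
  have f: "A_eigenvalue (of_nat q) N \<phi> i = of_real (f i)" for i
    by (simp add: A_eigenvalue_def f_def)
  have less: "f j < f i" if "i < j" "j \<le> N" for i j
  proof -
    have "real q ^ (N - j) < real q ^ (N - i)" "real q ^ i < real q ^ j"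
      using that assms(1) by (auto intro!: power_strict_increasing)
    then have "\<phi> * real q ^ (N - j) - real q ^ j < \<phi> * real q ^ (N - i) - real q ^ i"
      using assms(2) by (smt (verit) mult_less_cancel_left_pos)
    then show ?thesis using assms(1) by (simp add: f_def divide_strict_right_mono)
  qed
  fix i j assume "i \<in> {0..N}" "j \<in> {0..N}" "A_eigenvalue (of_nat q) N \<phi> i = A_eigenvalue (of_nat q) N \<phi> j"
  then show "i = j" using less[of i j] less[of j i] by (cases i j rule: linorder_cases) (auto simp: f)
qed

text \<open>Abstracts the subspace lattice to its levels and covers. \<open>card_common\<close> is
  the entrywise form of the commutator of \<open>L\<close> and \<open>R\<close>: common upper covers
  minus common lower ones.\<close>

locale cover_graph =
  fixes lev :: "'x::finite \<Rightarrow> nat" and cov :: "'x \<Rightarrow> 'x \<Rightarrow> bool" and N q :: nat and \<phi> :: real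
  assumes q_ge_2: "q \<ge> 2" and phi_pos: "\<phi> > 0"
    and lev_le: "lev y \<le> N"
    and lev_cov: "cov y z \<Longrightarrow> lev y = Suc (lev z)"
    and card_common: "lev y = lev z \<Longrightarrow>
      (of_nat (card {x. cov x y \<and> cov x z}) :: complex) = of_nat (card {x. cov y x \<and> cov z x}) +
      (if y = z then (of_nat q ^ (N - lev y) - of_nat q ^ lev y) / (of_nat q - 1) else 0)"
begin

abbreviation Q :: complex where "Q \<equiv> of_nat q"

definition A :: "complex ^ 'x ^ 'x" where
  "A = (\<chi> y z. if cov y z then 1 else if cov z y then of_real \<phi> * Q ^ lev y
         else if y = z then (of_real \<phi> - 1) / (Q - 1) * Q ^ lev y else 0)"

definition B :: "complex ^ 'x ^ 'x" where
  "B = (\<chi> y z. if y = z then Q powi (- int (lev y)) else 0)"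

definition Estar :: "nat \<Rightarrow> complex ^ 'x ^ 'x" where
  "Estar i = (\<chi> y z. if y = z \<and> lev y = i then 1 else 0)"

definition R :: "complex ^ 'x ^ 'x" where
  "R = (\<chi> y z. if cov y z then 1 else 0)"

definition L :: "complex ^ 'x ^ 'x" where
  "L = (\<chi> y z. if cov z y then 1 else 0)"

text \<open>The zero vector is homogeneous of every level, so no nonvanishing has to be carried
  along when \<open>R\<close> or \<open>L\<close> is applied.\<close>

definition homogeneous :: "nat \<Rightarrow> complex ^ 'x \<Rightarrow> bool" where
  "homogeneous i v \<longleftrightarrow> (\<forall>y. v $ y \<noteq> 0 \<longrightarrow> lev y = i)"

lemma Q_nonzero: "Q \<noteq> 0" and Q_power: "m > 0 \<Longrightarrow> Q ^ m \<noteq> 1"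
proof -
  show "Q \<noteq> 0" using q_ge_2 by simp
  assume "m > 0"
  then have "q ^ m \<noteq> 1" using q_ge_2 by simp
  then show "Q ^ m \<noteq> 1" by (metis of_nat_1 of_nat_eq_iff of_nat_power)
qed

lemma Q_inj: "Q ^ a = Q ^ b \<Longrightarrow> a = b"
proof -
  assume "Q ^ a = Q ^ b"
  then have "q ^ a = q ^ b" by (metis of_nat_eq_iff of_nat_power)
  then show "a = b" using q_ge_2 by (simp add: power_inject_exp)
qed

lemma R_nth: "(R *v v) $ y = (\<Sum>z | cov y z. v $ z)"
  using sum.inter_filter[of UNIV "\<lambda>z. v $ z" "cov y"]
  by (simp add: R_def matrix_vector_mult_def if_distrib[where f = "\<lambda>a. a * _"] cong: if_cong)

lemma L_nth: "(L *v v) $ z = (\<Sum>y | cov y z. v $ y)"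
  using sum.inter_filter[of UNIV "\<lambda>y. v $ y" "\<lambda>y. cov y z"]
  by (simp add: L_def matrix_vector_mult_def if_distrib[where f = "\<lambda>a. a * _"] cong: if_cong)

lemma homogeneous_R: "homogeneous i v \<Longrightarrow> homogeneous (Suc i) (R *v v)"
  unfolding homogeneous_def R_nth by (auto elim!: sum.not_neutral_contains_not_neutral simp: lev_cov)

lemma homogeneous_L: "homogeneous (Suc i) v \<Longrightarrow> homogeneous i (L *v v)"
  unfolding homogeneous_def L_nth
  by (auto elim!: sum.not_neutral_contains_not_neutral) (metis lev_cov nat.inject)

lemma L_homogeneous_0: "homogeneous 0 v \<Longrightarrow> L *v v = 0"
  unfolding homogeneous_def vec_eq_iff L_nth zero_index
  by (intro allI sum.neutral ballI) (metis lev_cov mem_Collect_eq nat.distinct(1))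

lemma homogeneous_above: "homogeneous i v \<Longrightarrow> N < i \<Longrightarrow> v = 0"
  unfolding homogeneous_def vec_eq_iff using lev_le by (metis not_le zero_index)

lemma A_nth: "(A *v v) $ y = (R *v v) $ y + of_real \<phi> * Q ^ lev y * (L *v v) $ y +
    (of_real \<phi> - 1) / (Q - 1) * Q ^ lev y * v $ y"
proof -
  have "A $ y $ z * v $ z = R $ y $ z * v $ z + of_real \<phi> * Q ^ lev y * (L $ y $ z * v $ z) +
      (if z = y then (of_real \<phi> - 1) / (Q - 1) * Q ^ lev y * v $ z else 0)" for z
  proof -
    have "\<not> (cov y z \<and> cov z y)" "\<not> cov y y" by (metis lev_cov n_not_Suc_n Suc_n_not_le_n le_SucI order_refl)+
    then show ?thesis by (auto simp: A_def R_def L_def)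
  qed
  then show ?thesis
    by (simp add: matrix_vector_mult_def sum.distrib sum_distrib_left)
qed

text \<open>\<open>L *v v\<close> sits on level \<open>i - 1\<close>, which explains the exponent;
  at \<open>i = 0\<close> the truncated difference does no harm because \<open>L *v v\<close> is
  zero.\<close>

lemma A_homogeneous:
  assumes "homogeneous i v"
  shows "A *v v = R *v v + (of_real \<phi> * Q ^ (i - 1)) *s (L *v v) + ((of_real \<phi> - 1) / (Q - 1) * Q ^ i) *s v"
proof -
  have 1: "Q ^ lev y * (L *v v) $ y = Q ^ (i - 1) * (L *v v) $ y" for y
  proof (cases i)
    case 0
    then show ?thesis using L_homogeneous_0[of v] assms by simp
  next
    case (Suc k)
    then show ?thesis using homogeneous_L[of k v] assms by (auto simp: homogeneous_def)
  qed
  have 2: "Q ^ lev y * v $ y = Q ^ i * v $ y" for y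
    using assms by (auto simp: homogeneous_def)
  show ?thesis
    by (simp only: vec_eq_iff A_nth mult.assoc 1 2 vector_add_component vector_smult_component simp_thms)
qed

lemma B_nth: "(B *v v) $ y = Q powi (- int (lev y)) * v $ y"
  by (simp add: B_def matrix_vector_mult_def if_distrib[where f = "\<lambda>a. a * _"] cong: if_cong)

lemma Estar_nth: "(Estar i *v v) $ y = (if lev y = i then v $ y else 0)"
proof -
  have "(Estar i *v v) $ y = (\<Sum>z\<in>UNIV. if y = z then (if lev y = i then v $ y else 0) else 0)"
    unfolding matrix_vector_mult_def Estar_def vec_lambda_beta by (rule sum.cong) auto
  then show ?thesis by simp
qed

lemma B_homogeneous: "homogeneous i v \<Longrightarrow> B *v v = (1 / Q ^ i) *s v"
  by (auto simp: vec_eq_iff B_nth homogeneous_def power_int_minus_divide)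

lemma Estar_homogeneous: "homogeneous i v \<Longrightarrow> Estar k *v v = (if k = i then v else 0)"
  by (auto simp: vec_eq_iff Estar_nth homogeneous_def)

lemma homogeneous_Estar: "homogeneous i (Estar i *v v)"
  by (simp add: homogeneous_def Estar_nth)

lemma sum_Estar: "(\<Sum>i\<le>N. Estar i *v v) = v"
  using lev_le by (simp add: vec_eq_iff Estar_nth)

text \<open>Entries of the two products count common upper and common lower covers. They can be
  nonzero only between equal levels, where \<open>card_common\<close> compares them.\<close>

lemma L_R: "L *v (R *v v) = R *v (L *v v) + (\<chi> z. (Q ^ (N - lev z) - Q ^ lev z) / (Q - 1) * v $ z)"
proof -
  have "(\<Sum>y | cov y z. \<Sum>x | cov y x. v $ x) =
      (\<Sum>y | cov z y. \<Sum>x | cov x y. v $ x) + (Q ^ (N - lev z) - Q ^ lev z) / (Q - 1) * v $ z" for z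
  proof -
    \<comment> \<open>Interchanging the sums collects, for each \<open>x\<close>, the number of
      common covers of \<open>x\<close> and \<open>z\<close>.\<close>
    have up: "(\<Sum>y | cov y z. \<Sum>x | cov y x. v $ x) = (\<Sum>x\<in>UNIV. of_nat (card {y. cov y z \<and> cov y x}) * v $ x)"
      using sum.swap_restrict[of "{y. cov y z}" "UNIV :: 'x set" "\<lambda>y x. v $ x" cov] by simp
    have down: "(\<Sum>y | cov z y. \<Sum>x | cov x y. v $ x) = (\<Sum>x\<in>UNIV. of_nat (card {y. cov z y \<and> cov x y}) * v $ x)"
      using sum.swap_restrict[of "{y. cov z y}" "UNIV :: 'x set" "\<lambda>y x. v $ x" "\<lambda>y x. cov x y"] by simp
    have "of_nat (card {y. cov y z \<and> cov y x}) * v $ x = of_nat (card {y. cov z y \<and> cov x y}) * v $ x +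
        (if x = z then (Q ^ (N - lev z) - Q ^ lev z) / (Q - 1) * v $ z else 0)" for x
    proof (cases "lev x = lev z")
      case True
      then show ?thesis using card_common[of z x] by (auto simp: distrib_right)
    next
      case False
      then have "\<not> (cov y z \<and> cov y x)" "\<not> (cov z y \<and> cov x y)" for y
        by (metis lev_cov nat.inject)+
      then have empty: "{y. cov y z \<and> cov y x} = {}" "{y. cov z y \<and> cov x y} = {}" by simp_all
      have "x \<noteq> z" using False by auto
      then show ?thesis unfolding empty by simp
    qed
    then show ?thesis unfolding up down by (simp add: sum.distrib)
  qed
  then show ?thesis by (simp add: vec_eq_iff R_nth L_nth)
qed

lemma L_R_homogeneous:
  "homogeneous i v \<Longrightarrow> L *v (R *v v) = R *v (L *v v) + ((Q ^ (N - i) - Q ^ i) / (Q - 1)) *s v"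
  unfolding L_R vec_eq_iff by (auto simp: homogeneous_def)

definition E :: "nat \<Rightarrow> complex ^ 'x ^ 'x" where
  "E i = (THE M. \<forall>\<mu> v. A *v v = \<mu> *s v \<longrightarrow> M *v v = (if \<mu> = A_eigenvalue Q N \<phi> i then v else 0))"

end

section \<open>The string generated by a lowest weight vector\<close>

locale lowest_weight = cover_graph +
  fixes r :: nat and w0 :: "complex ^ 'a"
  assumes homogeneous_w0: "homogeneous r w0" and L_w0: "L *v w0 = 0" and w0_nonzero: "w0 \<noteq> 0"
begin

definition w :: "nat \<Rightarrow> complex ^ 'a" where "w j = ((*v) R ^^ j) w0"
definition p :: complex where "p = Q ^ r"
text \<open>\<open>D_eq\<close> later identifies this with \<open>Q ^ d\<close>; the quotient makes
  sense before \<open>2 * r \<le> N\<close> is known.\<close>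

definition D :: complex where "D = Q ^ N / p ^ 2"
definition d :: nat where "d = N - 2 * r"

lemma w_0 [simp]: "w 0 = w0" and R_w: "R *v w j = w (Suc j)"
  by (simp_all add: w_def)

lemma homogeneous_w: "homogeneous (r + j) (w j)"
  by (induction j) (auto simp: homogeneous_w0 homogeneous_R simp flip: R_w)

lemma p_nonzero: "p \<noteq> 0" using Q_nonzero by (simp add: p_def)

lemma r_le: "r \<le> N"
  using homogeneous_above[OF homogeneous_w0] w0_nonzero by force

text \<open>Closed form of the sum of the commutator scalars on levels \<open>r\<close> to
  \<open>r + j\<close>, with \<open>Q ^ (N - r - k)\<close> written as
  \<open>p * D / Q ^ k\<close>.\<close>

definition c :: "nat \<Rightarrow> complex" where
  "c j = p * (Q * Q ^ j - 1) * (D - Q ^ j) / (Q ^ j * (Q - 1) ^ 2)"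

text \<open>Moving \<open>L\<close> past one more \<open>R\<close> adds the commutator scalar of the
  next level, which leads from \<open>c j\<close> to \<open>c (Suc j)\<close>.\<close>

lemma L_w: "L *v w (Suc j) = c j *s w j"
proof (induction j)
  case 0
  have "Q ^ (N - r) = D * p"
    using r_le Q_nonzero by (simp add: D_def p_def power2_eq_square power_diff)
  then have "(Q ^ (N - r) - Q ^ r) / (Q - 1) = p * (D - 1) / (Q - 1)"
    by (simp add: p_def[symmetric] right_diff_distrib mult.commute)
  also have "\<dots> = c 0" using Q_power[of 1] by (simp add: c_def power2_eq_square)
  finally have "(Q ^ (N - r) - Q ^ r) / (Q - 1) = c 0" .
  then show ?case
    using L_R_homogeneous[OF homogeneous_w[of 0]] R_w[of 0] by (simp add: L_w0)
next
  case (Suc j)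
  show ?case
  proof (cases "r + Suc j \<le> N")
    \<comment> \<open>Beyond level \<open>N\<close> the truncated exponent
      \<open>N - (r + Suc j)\<close> would be wrong, but the vector is zero there.\<close>
    case False
    then have "w (Suc j) = 0" using homogeneous_above[OF homogeneous_w] by simp
    then show ?thesis by (simp flip: R_w)
  next
    case True
    define t where "t = Q ^ j"
    have t: "t \<noteq> 0" using Q_nonzero by (simp add: t_def)
    have "Q ^ (N - (r + Suc j)) = D * p / (Q * t)"
      using True Q_nonzero by (simp add: D_def p_def t_def power2_eq_square power_diff power_add)
    moreover have "Q ^ (r + Suc j) = p * (Q * t)" by (simp add: p_def t_def power_add)
    moreover have "c j + (D * p / (Q * t) - p * (Q * t)) / (Q - 1) = c (Suc j)"
    proof -
      have nz: "Q - 1 \<noteq> 0" using Q_power[of 1] by simp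
      have clear: "(X / (t * e ^ 2) + (D * p / (Q * t) - p * (Q * t)) / e) * (Q * t * e ^ 2) =
          X * Q + (D * p - p * (Q * t) ^ 2) * e" if "e \<noteq> 0" for X e
        using that t Q_nonzero by (simp add: field_simps power2_eq_square)
      have "(c j + (D * p / (Q * t) - p * (Q * t)) / (Q - 1)) * (Q * t * (Q - 1) ^ 2) =
          p * (Q * t - 1) * (D - t) * Q + (D * p - p * (Q * t) ^ 2) * (Q - 1)"
        unfolding c_def t_def[symmetric] by (rule clear[OF nz])
      also have "\<dots> = p * (Q * (Q * t) - 1) * (D - Q * t)"
        by (simp add: algebra_simps power2_eq_square)
      also have "\<dots> = c (Suc j) * (Q * t * (Q - 1) ^ 2)"
        using nz t Q_nonzero unfolding c_def power_Suc t_def[symmetric] by simp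
      finally show ?thesis using nz t Q_nonzero by simp
    qed
    ultimately have "c j + (Q ^ (N - (r + Suc j)) - Q ^ (r + Suc j)) / (Q - 1) = c (Suc j)" by (simp only:)
    moreover have "L *v w (Suc (Suc j)) = c j *s w (Suc j) + ((Q ^ (N - (r + Suc j)) - Q ^ (r + Suc j)) / (Q - 1)) *s w (Suc j)"
      using L_R_homogeneous[OF homogeneous_w[of "Suc j"]] Suc by (simp only: R_w vec.scale)
    ultimately show ?thesis by (simp only: vector_sadd_rdistrib[symmetric])
  qed
qed

text \<open>Levels are bounded, so the string has a last nonzero vector \<open>w m\<close>. Applying
  \<open>L\<close> to \<open>w (Suc m) = 0\<close> forces \<open>c m = 0\<close>; the only factor
  that can vanish is \<open>D - Q ^ m\<close>, and comparing exponents gives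
  \<open>N = 2 * r + m\<close>.\<close>

lemma r_and_d: "2 * r \<le> N" and w_nonzero: "j \<le> d \<Longrightarrow> w j \<noteq> 0" and w_Suc_d: "w (Suc d) = 0"
proof -
  let ?m = "LEAST j. w j = 0"
  have "w (Suc N) = 0" using homogeneous_above[OF homogeneous_w] by simp
  then have m: "w ?m = 0" by (rule LeastI)
  then obtain m where m': "?m = Suc m" using w0_nonzero by (cases ?m) auto
  have nonzero: "w j \<noteq> 0" if "j \<le> m" for j using not_less_Least[of j "\<lambda>j. w j = 0"] that m' by auto
  have "c m *s w m = 0" using L_w[of m] m m' by simp
  then have "c m = 0" using nonzero[of m] by simp
  moreover have "Q * Q ^ m \<noteq> 1" using Q_power[of "Suc m"] by simp
  moreover have "Q - 1 \<noteq> 0" using Q_power[of 1] by simp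
  ultimately have "D = Q ^ m" using p_nonzero Q_nonzero by (simp add: c_def)
  then have "Q ^ N = Q ^ m * p ^ 2" using p_nonzero by (simp add: D_def field_simps)
  also have "\<dots> = Q ^ (2 * r + m)" by (simp add: p_def power_add power_mult mult.commute)
  finally have "Q ^ N = Q ^ (2 * r + m)" .
  then have N: "N = 2 * r + m" by (rule Q_inj)
  then have "d = m" unfolding d_def by simp
  then show "2 * r \<le> N" "j \<le> d \<Longrightarrow> w j \<noteq> 0" "w (Suc d) = 0"
    using N nonzero m m' by simp_all
qed

lemma N_eq: "2 * r + d = N" using r_and_d by (simp add: d_def)

lemma D_eq: "D = Q ^ d"
proof -
  have "Q ^ N = Q ^ (2 * r + d)" by (simp only: N_eq)
  also have "\<dots> = p ^ 2 * Q ^ d" by (simp add: p_def power_add power_mult mult.commute)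
  finally show ?thesis using p_nonzero by (simp add: D_def)
qed

end

subsection \<open>The two split forms of a string\<close>

context lowest_weight
begin

lemma A_w: "A *v w j = w (Suc j) + ((of_real \<phi> - 1) / (Q - 1) * p * Q ^ j) *s w j +
    (if j = 0 then 0 else (of_real \<phi> * p * Q ^ (j - 1) * c (j - 1)) *s w (j - 1))"
proof -
  have *: "A *v w j = w (Suc j) + (of_real \<phi> * Q ^ (r + j - 1)) *s (L *v w j) +
      ((of_real \<phi> - 1) / (Q - 1) * p * Q ^ j) *s w j"
    using A_homogeneous[OF homogeneous_w[of j]] by (simp add: R_w p_def power_add mult.assoc)
  show ?thesis
  proof (cases j)
    case 0
    then show ?thesis using * by (simp add: L_w0)
  next
    case (Suc k)
    then show ?thesis using * by (simp add: L_w p_def power_add vector_smult_assoc mult_ac add_ac)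
  qed
qed

sublocale s1: split_coefficients Q p D "of_real \<phi>" "-1"
  by unfold_locales (rule Q_nonzero Q_power p_nonzero | assumption)+

sublocale s2: split_coefficients Q p D "-1" "of_real \<phi>"
  by unfold_locales

text \<open>\<open>diag\<close> depends on \<alpha> and \<beta> only through their sum and
  \<open>super\<close> only through their product, so both orders of the pair describe the same
  action. This is why one string has two split forms.\<close>

lemma A_w_first: "A *v w j = w (Suc j) + s1.diag j *s w j + (if j = 0 then 0 else s1.super (j - 1) *s w (j - 1))"
  and A_w_second: "A *v w j = w (Suc j) + s2.diag j *s w j + (if j = 0 then 0 else s2.super (j - 1) *s w (j - 1))"
proof -
  have "s1.super k = of_real \<phi> * p * Q ^ k * c k" for k
    using Q_nonzero by (simp add: s1.super_def c_def power2_eq_square mult_ac)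
  moreover have "s2.super k = s1.super k" for k
    by (simp add: s1.super_def s2.super_def)
  moreover have "s1.diag k = (of_real \<phi> - 1) / (Q - 1) * p * Q ^ k" "s2.diag k = s1.diag k" for k
    by (simp_all add: s1.diag_def s2.diag_def)
  ultimately show "A *v w j = w (Suc j) + s1.diag j *s w j + (if j = 0 then 0 else s1.super (j - 1) *s w (j - 1))"
    "A *v w j = w (Suc j) + s2.diag j *s w j + (if j = 0 then 0 else s2.super (j - 1) *s w (j - 1))"
    using A_w[of j] by simp_all
qed

lemma B_w: "B *v w j = s1.tau j *s w j"
  using B_homogeneous[OF homogeneous_w[of j]] unfolding s1.tau_def by (simp add: p_def power_add)

lemma powers_rd:
  assumes "i \<le> d"
  shows "Q ^ (N - (r + i)) = p * D / Q ^ i" "Q ^ (r + (d - i)) = p * D / Q ^ i"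
    "Q ^ (r + i) = p * Q ^ i" "Q ^ (N - (r + (d - i))) = p * Q ^ i"
proof -
  have "N - (r + i) = r + (d - i)" "N - (r + (d - i)) = r + i" using N_eq assms by simp_all
  then show "Q ^ (N - (r + i)) = p * D / Q ^ i" "Q ^ (r + (d - i)) = p * D / Q ^ i"
    "Q ^ (r + i) = p * Q ^ i" "Q ^ (N - (r + (d - i))) = p * Q ^ i"
    using Q_nonzero assms by (simp_all add: p_def D_eq power_add power_diff)
qed

text \<open>Exchanging \<alpha> and \<beta> reverses the order of the eigenvalues, because passing
  from \<open>i\<close> to \<open>d - i\<close> swaps the two powers in
  \<open>powers_rd\<close>.\<close>

lemma theta_first: "i \<le> d \<Longrightarrow> s1.theta i = A_eigenvalue Q N \<phi> (r + i)"
  and theta_second: "i \<le> d \<Longrightarrow> s2.theta i = A_eigenvalue Q N \<phi> (r + (d - i))"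
  using powers_rd[of i] by (simp_all add: s1.theta_def s2.theta_def A_eigenvalue_def mult.assoc)

lemma inj_eigenvalue: "inj_on (A_eigenvalue Q N \<phi>) {0..N}"
  using q_ge_2 phi_pos by (rule inj_A_eigenvalue)

lemma inj_theta: "inj_on s1.theta {0..d}" "inj_on s2.theta {0..d}"
proof -
  have "i = j" if "s1.theta i = s1.theta j" "i \<le> d" "j \<le> d" for i j
    using inj_onD[OF inj_eigenvalue, of "r + i" "r + j"] that theta_first N_eq by simp
  then show "inj_on s1.theta {0..d}" by (auto intro: inj_onI)
  have "i = j" if "s2.theta i = s2.theta j" "i \<le> d" "j \<le> d" for i j
  proof -
    have "r + (d - i) = r + (d - j)"
      by (rule inj_onD[OF inj_eigenvalue]) (use that theta_second[of i] theta_second[of j] N_eq in auto)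
    then show ?thesis using that by simp
  qed
  then show "inj_on s2.theta {0..d}" by (auto intro: inj_onI)
qed

sublocale dual: eigenbasis B w s1.tau d
proof
  show "inj_on s1.tau {0..d}"
    using p_nonzero Q_nonzero Q_inj by (auto intro!: inj_onI simp: s1.tau_def)
qed (simp_all add: w_nonzero B_w)

text \<open>\<open>psi (Suc d)\<close> contains the factor \<open>D - Q ^ d\<close>, which is zero,
  so every lower coefficient vanishes; the top one multiplies \<open>w (Suc d) = 0\<close>.\<close>

lemma split_vector_end: "s1.split_vector w (Suc d) = 0" "s2.split_vector w (Suc d) = 0"
proof -
  have D: "D - Q ^ d = 0" unfolding D_eq by simp
  have "s1.psi (Suc d) = 0" unfolding s1.psi_Suc D by simp
  moreover have "s2.psi (Suc d) = 0" unfolding s2.psi_Suc D by simp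
  ultimately have "s1.coef (Suc d) j = 0" "s2.coef (Suc d) j = 0" if "j \<le> d" for j
    using s1.coef_Suc_left[OF that] s2.coef_Suc_left[OF that] Q_power[of "Suc d - j"] that
    by simp_all
  then show "s1.split_vector w (Suc d) = 0" "s2.split_vector w (Suc d) = 0"
    by (simp_all add: s1.split_vector_def s2.split_vector_def w_Suc_d)
qed

sublocale first: split_form A B "s1.split_vector w" s1.theta s1.tau s1.split d
proof
  have dim: "vec.dim (vec.span (s1.split_vector w ` {0..d})) = d + 1"
    by (simp only: s1.span_split_vector dual.dim_W)
  show "inj_on (s1.split_vector w) {0..d}" "vec.independent (s1.split_vector w ` {0..d})"
    using basis_if_dim_span[OF dim] by simp_all
  fix i assume "i \<le> d"
  then show "A *v s1.split_vector w i = s1.theta i *s s1.split_vector w i + (if i < d then s1.split_vector w (i + 1) else 0)"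
    using s1.split_vector_A[OF A_w_first, of i] split_vector_end by (cases "i = d") auto
qed (simp_all add: s1.split_vector_B[OF B_w] inj_theta)

text \<open>\<open>tau\<close> does not involve \<alpha> or \<beta>, so both split forms share
  \<open>s1.tau\<close>.\<close>

sublocale second: split_form A B "s2.split_vector w" s2.theta s1.tau s2.split d
proof
  have dim: "vec.dim (vec.span (s2.split_vector w ` {0..d})) = d + 1"
    by (simp only: s2.span_split_vector dual.dim_W)
  show "inj_on (s2.split_vector w) {0..d}" "vec.independent (s2.split_vector w ` {0..d})"
    using basis_if_dim_span[OF dim] by simp_all
  fix i assume "i \<le> d"
  then show "A *v s2.split_vector w i = s2.theta i *s s2.split_vector w i + (if i < d then s2.split_vector w (i + 1) else 0)"
    using s2.split_vector_A[OF A_w_second, of i] split_vector_end by (cases "i = d") auto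
qed (simp_all add: s2.split_vector_B[OF B_w] inj_theta)

lemma first_W: "first.W = vec.span (w ` {0..d})"
  by (simp only: first.W_eq s1.span_split_vector)

lemma second_W: "second.W = vec.span (w ` {0..d})"
  by (simp only: second.W_eq s2.span_split_vector)

lemma w_above: "d < j \<Longrightarrow> w j = 0"
proof (induction j)
  case (Suc j)
  then show ?case using w_Suc_d by (cases "j = d") (simp_all flip: R_w)
qed simp

end

subsection \<open>Diagonalizability\<close>

context cover_graph
begin

definition eigenvector_span :: "(complex ^ 'x) set" where
  "eigenvector_span = vec.span {v. \<exists>k\<le>N. A *v v = A_eigenvalue Q N \<phi> k *s v}"

lemma R_power_zero: "((*v) R ^^ j) 0 = 0" by (induction j) simp_all

lemma R_power_add: "((*v) R ^^ j) (x + y) = ((*v) R ^^ j) x + ((*v) R ^^ j) y"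
  by (induction j) (simp_all add: vec.add)

lemma R_power_sum: "finite I \<Longrightarrow> ((*v) R ^^ j) (\<Sum>i\<in>I. x i) = (\<Sum>i\<in>I. ((*v) R ^^ j) (x i))"
  by (induction I rule: finite_induct) (simp_all add: R_power_zero R_power_add)

text \<open>For nonzero \<open>b\<close> this is a vector of the string of \<open>b\<close>, which
  is spanned by the eigenvectors of \<open>A\<close> from the first split form.\<close>

lemma R_power_homogeneous_lowest:
  assumes "homogeneous i b" "L *v b = 0"
  shows "((*v) R ^^ j) b \<in> eigenvector_span"
proof (cases "b = 0")
  case True
  then show ?thesis by (simp add: R_power_zero eigenvector_span_def vec.span_zero)
next
  case False
  interpret lowest_weight lev cov N q \<phi> i b
    by unfold_locales (use assms False in auto)
  have "w j \<in> eigenvector_span"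
  proof (cases "j \<le> d")
    case True
    then have "w j \<in> first.W" unfolding first_W by (intro vec.span_base) auto
    also have "first.W \<subseteq> eigenvector_span"
      unfolding eigenvector_span_def
    proof (intro vec.span_mono image_subsetI CollectI)
      fix k assume "k \<in> {0..d}"
      then show "\<exists>l\<le>N. A *v first.v k = A_eigenvalue Q N \<phi> l *s first.v k"
        using first.eigen[of k] theta_first[of k] N_eq by (intro exI[of _ "i + k"]) simp
    qed
    finally show ?thesis .
  qed (simp add: w_above eigenvector_span_def vec.span_zero)
  then show ?thesis by (simp add: w_def)
qed

lemma L_Estar: "L *v (Estar (Suc k) *v b) = Estar k *v (L *v b)"
  unfolding vec_eq_iff L_nth Estar_nth by (auto intro!: sum.cong sum.neutral simp: lev_cov)

text \<open>\<open>L\<close> shifts levels by one, so it kills each level component of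
  \<open>b\<close> separately and the homogeneous case applies to each.\<close>

lemma R_power_lowest:
  assumes "L *v b = 0"
  shows "((*v) R ^^ j) b \<in> eigenvector_span"
proof -
  have "((*v) R ^^ j) b = (\<Sum>i\<le>N. ((*v) R ^^ j) (Estar i *v b))"
    by (simp add: sum_Estar flip: R_power_sum)
  also have "\<dots> \<in> eigenvector_span"
    unfolding eigenvector_span_def
  proof (rule vec.span_sum, fold eigenvector_span_def)
    fix i
    have "L *v (Estar i *v b) = 0"
      using L_homogeneous_0[OF homogeneous_Estar] assms by (cases i) (simp_all add: L_Estar)
    then show "((*v) R ^^ j) (Estar i *v b) \<in> eigenvector_span"
      by (rule R_power_homogeneous_lowest[OF homogeneous_Estar])
  qed
  finally show ?thesis .
qed

text \<open>\<open>inner\<close> is the real inner product; \<open>R\<close> and \<open>L\<close>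
  are transposes of each other with entries 0 and 1.\<close>

lemma inner_R: "inner (R *v a) b = inner a (L *v b)"
proof -
  have "inner (R *v a) b = (\<Sum>y\<in>UNIV. \<Sum>z | z \<in> UNIV \<and> cov y z. inner (a $ z) (b $ y))"
    by (simp add: inner_vec_def R_nth inner_sum_left)
  also have "\<dots> = (\<Sum>z\<in>UNIV. \<Sum>y | y \<in> UNIV \<and> cov y z. inner (a $ z) (b $ y))"
    by (rule sum.swap_restrict) simp_all
  also have "\<dots> = inner a (L *v b)"
    by (simp add: inner_vec_def L_nth inner_sum_right)
  finally show ?thesis .
qed

text \<open>Since \<open>L\<close> is adjoint to \<open>R\<close>, the orthogonal complement of the range of \<open>R\<close> is the kernel of \<open>L\<close>.\<close>

lemma range_R_plus_kernel_L: "\<exists>a b. v = R *v a + b \<and> L *v b = 0"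
proof -
  \<comment> \<open>Unqualified \<open>subspace\<close> and \<open>span\<close> are taken over the
    reals, where the orthogonal decomposition is available.\<close>
  have "subspace (range ((*v) R))"
    by (intro linear_subspace_image subspace_UNIV linearI)
      (simp_all add: vec.add vec_eq_iff R_nth scaleR_sum_right)
  then have span: "span (range ((*v) R)) = range ((*v) R)" by (simp add: span_eq_iff)
  obtain y b where y: "y \<in> span (range ((*v) R))" "v = y + b"
    and b: "\<And>x. x \<in> span (range ((*v) R)) \<Longrightarrow> orthogonal b x"
    using orthogonal_subspace_decomp_exists[of "range ((*v) R)" v] by metis
  have "inner (R *v (L *v b)) b = 0"
    using b[of "R *v (L *v b)"] unfolding span by (simp add: orthogonal_def inner_commute)
  then have "L *v b = 0" by (simp add: inner_R)
  then show ?thesis using y unfolding span by blast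
qed

lemma R_power_support: "(((*v) R ^^ n) v) $ y \<noteq> 0 \<Longrightarrow> n \<le> lev y"
proof (induction n arbitrary: y)
  case (Suc n)
  then obtain z where "cov y z" "(((*v) R ^^ n) v) $ z \<noteq> 0"
    by (auto simp: R_nth elim!: sum.not_neutral_contains_not_neutral)
  then show ?case using Suc.IH lev_cov by fastforce
qed simp

text \<open>Splitting \<open>u\<close> repeatedly into \<open>R *v a + b\<close> with
  \<open>L *v b = 0\<close> pushes the remainder into the range of ever higher powers of
  \<open>R\<close>; the power \<open>N + 1\<close> is zero because levels are at most
  \<open>N\<close>.\<close>

lemma eigenvector_span_UNIV: "v \<in> eigenvector_span"
proof -
  have "\<exists>u. v - ((*v) R ^^ n) u \<in> eigenvector_span" for n
  proof (induction n)
    case 0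
    show ?case by (intro exI[of _ v]) (simp add: eigenvector_span_def vec.span_zero)
  next
    case (Suc n)
    then obtain u where u: "v - ((*v) R ^^ n) u \<in> eigenvector_span" by blast
    obtain a b where ab: "u = R *v a + b" "L *v b = 0" using range_R_plus_kernel_L by blast
    have "((*v) R ^^ n) u = ((*v) R ^^ Suc n) a + ((*v) R ^^ n) b"
      by (simp add: ab(1) R_power_add funpow_Suc_right del: funpow.simps)
    then have "v - ((*v) R ^^ Suc n) a = (v - ((*v) R ^^ n) u) + ((*v) R ^^ n) b" by simp
    also have "\<dots> \<in> eigenvector_span"
      using u R_power_lowest[OF ab(2)] unfolding eigenvector_span_def by (rule vec.span_add)
    finally show ?case by blast
  qed
  then obtain u where "v - ((*v) R ^^ Suc N) u \<in> eigenvector_span" by blast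
  moreover have "((*v) R ^^ Suc N) u = 0"
    unfolding vec_eq_iff using R_power_support[of "Suc N" u] lev_le by (metis Suc_n_not_le_n order_trans zero_index)
  ultimately show ?thesis by simp
qed

section \<open>Spectrum and primitive idempotents of \<open>A\<close>\<close>

lemma A_eigenvalue_cases:
  assumes "A *v v = \<mu> *s v" "v \<noteq> 0"
  shows "\<mu> \<in> A_eigenvalue Q N \<phi> ` {0..N}"
proof -
  obtain P where P: "\<And>\<mu> x. A *v x = \<mu> *s x \<Longrightarrow> P *v x = (\<Prod>k\<in>A_eigenvalue Q N \<phi> ` {0..N}. \<mu> - k) *s x"
    using gen_algebra_eigenpolynomial[OF gen_algebra.gen, of A "{A}" "A_eigenvalue Q N \<phi> ` {0..N}"] by blast
  have "P *v x = 0" if "A *v x = A_eigenvalue Q N \<phi> k *s x" "k \<le> N" for x k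
    using P[OF that(1)] that(2) by (auto simp: prod_zero_iff)
  then have "P *v v \<in> {0}"
    by - (rule matrix_vector_span_subset[OF _ _ eigenvector_span_UNIV[unfolded eigenvector_span_def]], auto)
  then have "(\<Prod>k\<in>A_eigenvalue Q N \<phi> ` {0..N}. \<mu> - k) = 0" using P[OF assms(1)] assms(2) by simp
  then show ?thesis by auto
qed

text \<open>The \<open>THE\<close> in \<open>E\<close> is resolved by Lagrange interpolation for
  existence and, for uniqueness, by the eigenvectors spanning the whole space.\<close>

lemma E_eigenvector:
  assumes "i \<le> N" "A *v v = \<mu> *s v"
  shows "E i *v v = (if \<mu> = A_eigenvalue Q N \<phi> i then v else 0)"
proof -
  let ?\<theta> = "A_eigenvalue Q N \<phi>"
  let ?spec = "\<lambda>M. \<forall>\<mu> v. A *v v = \<mu> *s v \<longrightarrow> M *v v = (if \<mu> = ?\<theta> i then v else 0)"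
  have "?\<theta> i \<notin> ?\<theta> ` ({0..N} - {i})"
    using inj_A_eigenvalue[OF q_ge_2 phi_pos, of N] assms(1) by (auto dest: inj_onD)
  then obtain P where P: "\<And>\<mu> x. A *v x = \<mu> *s x \<Longrightarrow> \<mu> \<in> insert (?\<theta> i) (?\<theta> ` ({0..N} - {i})) \<Longrightarrow>
      P *v x = (if \<mu> = ?\<theta> i then x else 0)"
    using gen_algebra_eigenprojector[OF gen_algebra.gen, of A "{A}" "?\<theta> ` ({0..N} - {i})" "?\<theta> i"] by blast
  have spec: "?spec P"
  proof (intro allI impI)
    fix \<mu> x assume x: "A *v x = \<mu> *s x"
    show "P *v x = (if \<mu> = ?\<theta> i then x else 0)"
    proof (cases "x = 0")
      case False
      then have "\<mu> \<in> insert (?\<theta> i) (?\<theta> ` ({0..N} - {i}))" using A_eigenvalue_cases[OF x] by blast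
      then show ?thesis by (rule P[OF x])
    qed simp
  qed
  have "E i = P"
    unfolding E_def
  proof (rule the_equality)
    show "?spec P" by (rule spec)
  next
    fix M assume M: "?spec M"
    have agree: "M *v y = P *v y" if y: "y \<in> {v. \<exists>k\<le>N. A *v v = ?\<theta> k *s v}" for y
    proof -
      obtain k where "A *v y = ?\<theta> k *s y" using y by blast
      then have "M *v y = (if ?\<theta> k = ?\<theta> i then y else 0)" "P *v y = (if ?\<theta> k = ?\<theta> i then y else 0)"
        using M spec by blast+
      then show ?thesis by simp
    qed
    show "M = P"
      unfolding matrix_eq
      using matrix_vector_eq_on_span[OF agree eigenvector_span_UNIV[unfolded eigenvector_span_def]] by blast
  qed
  then show ?thesis using spec assms(2) by simp
qed

end

subsection \<open>The Leonard system of a module\<close>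

text \<open>The projections \<open>Estar i\<close> are polynomials in \<open>B\<close>, so they
  preserve \<open>W\<close>, which therefore contains a nonzero vector of level \<open>r\<close>. If
  \<open>L\<close> did not kill it, \<open>A\<close> would produce a component on level
  \<open>r - 1\<close>, against minimality.\<close>

lemma (in cover_graph) exists_lowest_weight:
  assumes W: "submodule (gen_algebra {A, B}) W" "W \<noteq> {0}"
    and r: "r = Min {i \<in> {0..N}. (\<lambda>x. Estar i *v x) ` W \<noteq> {0}}"
  shows "\<exists>w0\<in>W. lowest_weight lev cov N q \<phi> r w0"
proof -
  have subspace: "vec.subspace W" and A_W: "\<And>x. x \<in> W \<Longrightarrow> A *v x \<in> W"
    and alg: "\<And>M x. M \<in> gen_algebra {A, B} \<Longrightarrow> x \<in> W \<Longrightarrow> M *v x \<in> W"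
    using W(1) gen_algebra.gen[of A "{A, B}"] by (auto simp: submodule_def)
  have axis: "homogeneous (lev y) (axis y 1)" for y
    by (simp add: homogeneous_def axis_def)
  have Estar_W: "Estar i *v x \<in> W" if i: "i \<le> N" and x: "x \<in> W" for i x
  proof -
    have inj: "1 / Q ^ j = 1 / Q ^ k \<longleftrightarrow> j = k" for j k
      using Q_inj[of j k] Q_nonzero by auto
    have "1 / Q ^ i \<notin> (\<lambda>k. 1 / Q ^ k) ` ({0..N} - {i})" using inj by auto
    then obtain P where P: "P \<in> gen_algebra {A, B}" "\<And>\<mu> x. B *v x = \<mu> *s x \<Longrightarrow>
        \<mu> \<in> insert (1 / Q ^ i) ((\<lambda>k. 1 / Q ^ k) ` ({0..N} - {i})) \<Longrightarrow> P *v x = (if \<mu> = 1 / Q ^ i then x else 0)"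
      using gen_algebra_eigenprojector[OF gen_algebra.gen, of B "{A, B}" "(\<lambda>k. 1 / Q ^ k) ` ({0..N} - {i})" "1 / Q ^ i"]
      by blast
    \<comment> \<open>Standard basis vectors are homogeneous, hence eigenvectors of
      \<open>B\<close>; agreement on them makes the interpolating matrix equal to
      \<open>Estar i\<close>.\<close>
    have "P *v axis y 1 = Estar i *v axis y 1" for y
    proof -
      have "1 / Q ^ lev y \<in> insert (1 / Q ^ i) ((\<lambda>k. 1 / Q ^ k) ` ({0..N} - {i}))"
        using lev_le[of y] by (cases "lev y = i") auto
      then have "P *v axis y 1 = (if lev y = i then axis y 1 else 0)"
        using P(2)[OF B_homogeneous[OF axis]] unfolding inj by blast
      also have "\<dots> = Estar i *v axis y 1"
        using Estar_homogeneous[OF axis, of i y] by auto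
      finally show ?thesis .
    qed
    then have "(P *v axis y 1) $ a = (Estar i *v axis y 1) $ a" for a y by simp
    moreover have "(M *v axis y 1) $ a = M $ a $ y" for M :: "complex ^ 'x ^ 'x" and a y
      by (simp add: matrix_vector_mult_def axis_def if_distrib[where f = "\<lambda>b. _ * b"] cong: if_cong)
    ultimately have "P $ a $ y = Estar i $ a $ y" for a y by metis
    then have "P = Estar i" by (simp add: vec_eq_iff)
    then show ?thesis using alg[OF P(1) x] by simp
  qed
  let ?I = "{i \<in> {0..N}. (\<lambda>x. Estar i *v x) ` W \<noteq> {0}}"
  have zero: "0 \<in> W" using subspace by (rule vec.subspace_0)
  have mem_I: "i \<in> ?I" if "i \<le> N" "x \<in> W" "Estar i *v x \<noteq> 0" for i x
    using that by auto
  obtain x where x: "x \<in> W" "x \<noteq> 0" using W(2) zero by blast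
  then obtain y where "x $ y \<noteq> 0" by (auto simp: vec_eq_iff)
  then have "(Estar (lev y) *v x) $ y \<noteq> 0" by (simp add: Estar_nth)
  then have "Estar (lev y) *v x \<noteq> 0" by (metis zero_index)
  then have "?I \<noteq> {}" using mem_I[OF lev_le x(1)] by blast
  then have "r \<in> ?I" unfolding r by (intro Min_in) auto
  then have "r \<le> N" "(\<lambda>x. Estar r *v x) ` W \<noteq> {0}" by simp_all
  moreover have "0 \<in> (\<lambda>x. Estar r *v x) ` W" using zero by (intro image_eqI[of _ _ 0]) simp_all
  ultimately obtain x0 where x0: "x0 \<in> W" "Estar r *v x0 \<noteq> 0" by blast
  define w0 where "w0 = Estar r *v x0"
  have w0: "w0 \<in> W" "homogeneous r w0" "w0 \<noteq> 0"
    using Estar_W[OF \<open>r \<le> N\<close> x0(1)] homogeneous_Estar x0(2) by (simp_all add: w0_def)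
  have "L *v w0 = 0"
  proof (cases r)
    case 0
    then show ?thesis using L_homogeneous_0 w0(2) by simp
  next
    case (Suc k)
    have "\<not> Estar k *v (A *v w0) \<noteq> 0"
    proof
      assume "Estar k *v (A *v w0) \<noteq> 0"
      then have "k \<in> ?I" using A_W w0(1) Suc \<open>r \<le> N\<close> by (intro mem_I[of k "A *v w0"]) auto
      then have "r \<le> k" unfolding r by (intro Min_le) auto
      then show False using Suc by simp
    qed
    \<comment> \<open>The \<open>R\<close> part lies on level \<open>r + 1\<close> and the diagonal
      part on level \<open>r\<close>, so only the \<open>L\<close> part survives the projection to
      level \<open>k\<close>.\<close>
    moreover have "Estar k *v (A *v w0) = (of_real \<phi> * Q ^ k) *s (L *v w0)"
      unfolding A_homogeneous[OF w0(2)] vec.add vec.scale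
      using Estar_homogeneous[OF homogeneous_R[OF w0(2)], of k] Estar_homogeneous[OF w0(2), of k]
        Estar_homogeneous[OF homogeneous_L, of k w0 k] w0(2) Suc by simp
    ultimately show ?thesis using phi_pos Q_nonzero by simp
  qed
  then have "lowest_weight lev cov N q \<phi> r w0" using w0 by unfold_locales
  then show ?thesis using w0(1) by blast
qed

section \<open>Irreducible modules as strings, and their Leonard systems\<close>

context lowest_weight
begin

abbreviation U :: "(complex ^ 'a) set" where "U \<equiv> vec.span (w ` {0..d})"

lemma U_submodule: "submodule (gen_algebra {A, B}) U"
proof -
  have in_U: "w j \<in> U" for j
    by (cases "j \<le> d") (auto simp: w_above vec.span_zero intro: vec.span_base)
  have "A *v w j \<in> U" for j
    using in_U in_U[of 0] unfolding A_w by (auto intro!: vec.span_add vec.span_scale simp: vec.span_zero)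
  then have "A *v x \<in> U" if "x \<in> U" for x
    by - (rule matrix_vector_span_subset[OF _ _ that], auto)
  then show ?thesis using dual.M_W by (simp add: submodule_gen_algebra_iff)
qed

text \<open>Solving \<open>A_w\<close> for \<open>w (Suc k)\<close> shows by induction that
  \<open>W\<close> contains the string, which is itself a nonzero submodule.\<close>

lemma irreducible_eq_U:
  assumes "irreducible_submodule (gen_algebra {A, B}) W" "w0 \<in> W"
  shows "W = U"
proof -
  have W: "vec.subspace W" "\<And>x. x \<in> W \<Longrightarrow> A *v x \<in> W" "\<And>x. x \<in> W \<Longrightarrow> B *v x \<in> W"
    using assms(1) by (auto simp: irreducible_submodule_def submodule_gen_algebra_iff)
  have "w j \<in> W" for j
  proof (induction j rule: less_induct)
    case (less j)
    show ?case
    proof (cases j)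
      case (Suc k)
      have "(if k = 0 then 0 else (of_real \<phi> * p * Q ^ (k - 1) * c (k - 1)) *s w (k - 1)) \<in> W"
        using less[of "k - 1"] Suc W(1) by (auto intro: vec.subspace_0 vec.subspace_scale)
      moreover have "A *v w k \<in> W" "((of_real \<phi> - 1) / (Q - 1) * p * Q ^ k) *s w k \<in> W"
        using less[of k] Suc W by (auto intro: vec.subspace_scale)
      ultimately have "A *v w k - ((of_real \<phi> - 1) / (Q - 1) * p * Q ^ k) *s w k -
          (if k = 0 then 0 else (of_real \<phi> * p * Q ^ (k - 1) * c (k - 1)) *s w (k - 1)) \<in> W"
        using W(1) by (intro vec.subspace_diff)
      then show ?thesis unfolding A_w Suc by (simp add: algebra_simps)
    qed (simp add: assms(2))
  qed
  then have "U \<subseteq> W" using W(1) by (intro vec.span_minimal) auto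
  moreover have "U \<noteq> {0}" using dual.v_in_W[of 0] w0_nonzero by auto
  ultimately show ?thesis using assms(1) U_submodule by (auto simp: irreducible_submodule_def)
qed

definition Phi :: "'a leonard_data" where
  "Phi = \<lparr> lspace = U, diam = d, opr = (\<lambda>x. A *v x), idems = (\<lambda>i x. E (r + i) *v x),
     dual_opr = (\<lambda>x. B *v x), dual_idems = (\<lambda>i x. Estar (r + i) *v x) \<rparr>"

lemma Phi_sel [simp]:
  "lspace Phi = U" "diam Phi = d" "opr Phi = (*v) A" "idems Phi i = (*v) (E (r + i))"
  "dual_opr Phi = (*v) B" "dual_idems Phi i = (*v) (Estar (r + i))"
  by (simp_all add: Phi_def)

lemma E_first: "i \<le> d \<Longrightarrow> k \<le> d \<Longrightarrow> E (r + i) *v first.v k = (if k = i then first.v k else 0)"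
  using E_eigenvector[of "r + i" "first.v k" "s1.theta k"] first.eigen[of k] theta_first[of i]
    inj_onD[OF inj_theta(1), of k i] N_eq by auto

lemma E_second: "i \<le> d \<Longrightarrow> k \<le> d \<Longrightarrow> E (r + (d - i)) *v second.v k = (if k = i then second.v k else 0)"
  using E_eigenvector[of "r + (d - i)" "second.v k" "s2.theta k"] second.eigen[of k] theta_second[of i]
    inj_onD[OF inj_theta(2), of k i] N_eq by auto

lemma Estar_w: "Estar (r + i) *v w k = (if k = i then w k else 0)"
  using Estar_homogeneous[OF homogeneous_w, of "r + i" k] by auto

text \<open>Both vectors are eigenvectors of \<open>A\<close> for
  \<open>A_eigenvalue Q N \<phi> (r + j)\<close>, and the eigenspaces on the string are
  lines.\<close>

lemma second_v_multiple:
  assumes "j \<le> d"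
  obtains a where "a \<noteq> 0" "second.v (d - j) = a *s first.v j"
proof -
  have v: "second.v (d - j) \<in> first.W" "second.v (d - j) \<noteq> 0"
    using second.v_in_W[of "d - j"] second.v_nonzero[of "d - j"] unfolding first_W second_W by simp_all
  have "A *v second.v (d - j) = s1.theta j *s second.v (d - j)"
    using second.eigen[of "d - j"] theta_second[of "d - j"] theta_first[of j] assms by simp
  then obtain i where "i \<le> d" "s1.theta j = s1.theta i" "second.v (d - j) \<in> vec.span {first.v i}"
    using first.eigenvector_in_W v by metis
  moreover from this have "j = i" using inj_onD[OF inj_theta(1), of j i] assms by simp
  ultimately obtain a where "second.v (d - j) = a *s first.v j" by (auto simp: vec.span_singleton)
  then show ?thesis using that v by auto
qed

text \<open>The first split form settles \<open>i + 1 < j\<close>. For \<open>j + 1 < i\<close> the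
  second form is used, whose index reversal makes this the same situation for \<open>d - i\<close>
  and \<open>d - j\<close>.\<close>

lemma E_B_first_v:
  assumes "i \<le> d" "j \<le> d" "\<bar>int i - int j\<bar> > 1"
  shows "E (r + i) *v (B *v first.v j) = 0"
proof (cases "i < j")
  case True
  then show ?thesis using assms E_first by (intro first.projector_B_v) auto
next
  case False
  obtain a where a: "a \<noteq> 0" "second.v (d - j) = a *s first.v j" using second_v_multiple assms(2) by blast
  have "E (r + (d - (d - i))) *v (B *v second.v (d - j)) = 0"
    by (rule second.projector_B_v[of _ "d - i"]) (use E_second[of "d - i"] False assms in auto)
  then show ?thesis using a assms(1) by (simp add: vec.scale)
qed

lemma leonard_system_Phi:
  assumes irr: "irreducible_submodule (gen_algebra {A, B}) U"
  shows "leonard_system Phi"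
proof -
  have irr': "irreducible_submodule (gen_algebra {A, B}) first.W"
    "irreducible_submodule (gen_algebra {B, A}) dual.W"
    using irr unfolding first_W by (simp_all add: insert_commute)
  have "tridiagonal_on first.W d (\<lambda>i w. E (r + i) *v w) ((*v) B)"
    by (rule first.tridiagonal_if_irreducible[OF irr'(1)]) (use E_first E_B_first_v in auto)
  moreover have "tridiagonal_on dual.W d (\<lambda>i w. Estar (r + i) *v w) ((*v) A)"
    by (rule dual.tridiagonal_if_irreducible[OF irr'(2)])
      (auto simp: Estar_w A_w vec.add vec.scale)
  moreover have "idempotent_ordering_on first.W d ((*v) A) (\<lambda>i. (*v) (E (r + i)))"
    unfolding idempotent_ordering_on_def
    using first.bij_eigenvalues first.primitive_idempotent[OF _ E_first] by blast
  moreover have "idempotent_ordering_on dual.W d ((*v) B) (\<lambda>i. (*v) (Estar (r + i)))"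
    unfolding idempotent_ordering_on_def
    using dual.bij_eigenvalues dual.primitive_idempotent[OF _ Estar_w] by blast
  moreover have "idems Phi = (\<lambda>i. (*v) (E (r + i)))" "dual_idems Phi = (\<lambda>i. (*v) (Estar (r + i)))"
    by (simp_all add: fun_eq_iff)
  ultimately show ?thesis
    using first.multiplicity_free dual.multiplicity_free dual.dim_W
    by (simp add: leonard_system_def first_W)
qed

section \<open>The parameter array\<close>

lemma eigenvalue_seq_Phi: "i \<le> d \<Longrightarrow> eigenvalue_seq Phi i = s1.theta i"
  using first.the_eigenvalue[OF _ E_first, of i] by (simp add: eigenvalue_seq_def first_W)

lemma dual_eigenvalue_seq_Phi: "i \<le> d \<Longrightarrow> dual_eigenvalue_seq Phi i = s1.tau i"
  using dual.the_eigenvalue[OF _ Estar_w, of i] by (simp add: dual_eigenvalue_seq_def)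

text \<open>In any competing basis the first vector is an eigenvector of \<open>B\<close> for
  \<open>s1.tau 0\<close>, hence a multiple of \<open>w 0\<close>; \<open>split_form_unique\<close>
  then fixes the scalars. This resolves the \<open>THE\<close> in both split sequences.\<close>

lemma split_seq_eq:
  assumes sf: "split_form A B u \<theta> s1.tau g d" and u0: "u 0 = w 0"
    and span: "vec.span (u ` {0..d}) = U" and nonzero: "\<And>i. i \<in> {1..d} \<Longrightarrow> g i \<noteq> 0"
    and th: "\<And>i. i \<le> d \<Longrightarrow> th i = \<theta> i" and i: "i \<in> {1..d}"
  shows "(THE c. \<exists>f. split_scalars Phi th f \<and> f i = c) = g i"
proof (rule the_equality)
  interpret sf: split_form A B u \<theta> s1.tau g d by (rule sf)
  have "split_scalars Phi th g"
    unfolding split_scalars_def Phi_sel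
    using nonzero sf.inj_u sf.independent_u span sf.A_u sf.B_u th dual_eigenvalue_seq_Phi
    by (intro conjI exI[of _ u]) auto
  then show "\<exists>f. split_scalars Phi th f \<and> f i = g i" by blast
  fix a assume "\<exists>f. split_scalars Phi th f \<and> f i = a"
  then obtain f where f: "split_scalars Phi th f" "f i = a" by blast
  obtain u' where u': "inj_on u' {0..d}" "vec.independent (u' ` {0..d})" "vec.span (u' ` {0..d}) = U"
    "\<And>i. i \<le> d \<Longrightarrow> A *v u' i = th i *s u' i + (if i < d then u' (i + 1) else 0)"
    "\<And>i. i \<le> d \<Longrightarrow> B *v u' i = dual_eigenvalue_seq Phi i *s u' i + (if 0 < i then f i *s u' (i - 1) else 0)"
    using f(1) unfolding split_scalars_def Phi_sel by blast
  interpret sf': split_form A B u' \<theta> s1.tau f d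
    by unfold_locales (use u' th dual_eigenvalue_seq_Phi sf.inj_\<theta> in auto)
  have "u' 0 \<in> eigenspace_on U ((*v) B) (s1.tau 0)"
    using sf'.B_u[of 0] u'(3) vec.span_base[of "u' 0" "u' ` {0..d}"] by (simp add: eigenspace_on_def)
  then have "u' 0 \<in> vec.span {u 0}" using dual.eigenspace_eq[of 0] u0 by simp
  then obtain k where k: "u' 0 = k *s u 0" by (auto simp: vec.span_singleton)
  then show "a = g i" using split_form_unique[OF sf sf'.split_form_axioms k i] f(2) by simp
qed

lemma split_nonzero: "i \<in> {1..d} \<Longrightarrow> s1.split i \<noteq> 0" "i \<in> {1..d} \<Longrightarrow> s2.split i \<noteq> 0"
proof -
  assume i: "i \<in> {1..d}"
  have "Q * D \<noteq> Q ^ i" unfolding D_eq using Q_inj[of "Suc d" i] i by auto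
  then show "s1.split i \<noteq> 0" "s2.split i \<noteq> 0"
    using i Q_power[of i] Q_power[of 1] Q_nonzero phi_pos by (auto simp: s1.split_def s2.split_def)
qed

lemma first_split_seq_Phi: "i \<in> {1..d} \<Longrightarrow> first_split_seq Phi i = s1.split i"
  unfolding first_split_seq_def
  by (rule split_seq_eq[OF first.split_form_axioms _ s1.span_split_vector])
    (simp_all add: s1.split_vector_def split_nonzero eigenvalue_seq_Phi)

lemma second_split_seq_Phi: "i \<in> {1..d} \<Longrightarrow> second_split_seq Phi i = s2.split i"
  unfolding second_split_seq_def
  by (rule split_seq_eq[OF second.split_form_axioms _ s2.span_split_vector])
    (simp_all add: s2.split_vector_def split_nonzero eigenvalue_seq_Phi theta_first theta_second)

lemma dual_q_Krawtchouk_Phi: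
  "dual_q_Krawtchouk_type Q Phi d (of_real \<phi> * Q ^ (N - r) / (Q - 1)) (Q powi (- int r))
    (- (1 / of_real \<phi>) * Q powi (2 * int r - int N - 1))
    ((of_real \<phi> * Q ^ (N - r) - Q ^ r) / (Q - 1)) (Q powi (- int r))"
proof -
  define e where "e = Q - 1"
  have e: "e \<noteq> 0" using Q_power[of 1] by (simp add: e_def)
  define f :: complex where "f = of_real \<phi>"
  have f: "f \<noteq> 0" using phi_pos by (simp add: f_def)
  have D: "D \<noteq> 0" unfolding D_eq using Q_nonzero by simp
  have QNr: "Q ^ (N - r) = p * D" using powers_rd(1)[of 0] by simp
  have Qr: "Q powi (- int r) = 1 / p" by (simp add: p_def power_int_minus_divide)
  \<comment> \<open>The exponent is \<open>- (d + 1)\<close>, and \<open>D\<close> is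
    \<open>Q ^ d\<close>.\<close>
  have s: "Q powi (2 * int r - int N - 1) = 1 / (Q * D)"
  proof -
    have "2 * int r - int N - 1 = - int (Suc d)" using N_eq by linarith
    then show ?thesis by (simp only: power_int_minus_divide power_int_of_nat power_Suc D_eq[symmetric])
  qed
  have Qi: "Q powi (- int i) = 1 / Q ^ i" for i by (simp add: power_int_minus_divide)
  show ?thesis
    unfolding dual_q_Krawtchouk_type_def Phi_sel s Qr Qi QNr e_def[symmetric] f_def[symmetric] p_def[symmetric]
  proof (intro conjI allI impI ballI)
    fix i
    define t where "t = Q ^ i"
    have t: "t \<noteq> 0" using Q_nonzero by (simp add: t_def)
    show "dual_eigenvalue_seq Phi i = 1 / p + 1 / p * (1 - Q ^ i) * (1 / Q ^ i)" if "i \<le> d"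
      using that p_nonzero t by (simp add: dual_eigenvalue_seq_Phi s1.tau_def t_def[symmetric] field_simps)
    show "eigenvalue_seq Phi i = (f * (p * D) - p) / e +
        f * (p * D) / e * (1 - Q ^ i) * (1 - - (1 / f) * (1 / (Q * D)) * Q ^ (i + 1)) * (1 / Q ^ i)" if "i \<le> d"
    proof -
      have 1: "f * (p * D) / e * (1 - t) * (1 - - (1 / f) * (1 / (Q * D)) * (Q * t)) * (1 / t) =
          p / e * (1 - t) * (f * D + t) / t"
        using f D Q_nonzero t e by (simp add: field_simps)
      have 2: "(f * (p * D) - p) / e + p / e * (1 - t) * (f * D + t) / t = (f * p * D / t - p * t) / e"
        using t e by (simp add: field_simps)
      have 3: "Q ^ (i + 1) = Q * t" by (simp add: t_def)
      have "eigenvalue_seq Phi i = (f * p * D / t + - 1 * p * t) / e"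
        by (simp only: eigenvalue_seq_Phi[OF that] s1.theta_def t_def e_def f_def)
      then show ?thesis unfolding 3 t_def[symmetric] 1 2 by simp
    qed
    assume i: "i \<in> {1..d}"
    \<comment> \<open>The integer powers are expressed by \<open>t\<close>, \<open>Q\<close> and
      \<open>D\<close>, which leaves rational identities.\<close>
    have t2: "Q ^ (2 * i) = t * t" by (simp add: t_def mult_2 power_add)
    have t2': "Q powi (2 * int i) = t * t" using power_int_of_nat[of Q "2 * i"] by (simp add: t2)
    have p1: "Q powi (1 - 2 * int i) = Q / (t * t)"
      using Q_nonzero by (subst power_int_diff) (simp_all only: t2' power_int_1_right simp_thms)
    have "Q powi (int i - int (Suc d)) = t / (Q * D)"
      using Q_nonzero by (subst power_int_diff) (simp_all only: power_int_of_nat power_Suc t_def D_eq simp_thms)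
    then have p2: "Q powi (int i - int d - 1) = t / (Q * D)" by (simp add: diff_diff_eq add.commute)
    have "Q powi (int (Suc (Suc d)) - 2 * int i) = Q * Q * D / (t * t)"
      using Q_nonzero by (subst power_int_diff) (simp_all only: power_int_of_nat power_Suc t2' D_eq simp_thms mult.assoc)
    then have p3: "Q powi (int d + 2 - 2 * int i) = Q * Q * D / (t * t)" by (simp add: add.commute)
    have "f * (p * D) / e * (1 / p) * (Q / (t * t)) * (1 - t) * (1 - t / (Q * D)) =
        f / e * (1 - t) * (Q * D - t) / (t * t)"
      using p_nonzero D Q_nonzero t e by (simp add: field_simps)
    then show "first_split_seq Phi i =
        f * (p * D) / e * (1 / p) * Q powi (1 - 2 * int i) * (1 - Q ^ i) * (1 - Q powi (int i - int d - 1))"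
      unfolding p1 p2 first_split_seq_Phi[OF i] s1.split_def t2 unfolding t_def[symmetric] e_def[symmetric] f_def[symmetric]
      by simp
    have "f * (p * D) / e * (1 / p) * (- (1 / f) * (1 / (Q * D))) * (Q * Q * D / (t * t)) * (1 - t) * (1 - t / (Q * D)) =
        - 1 / e * (1 - t) * (Q * D - t) / (t * t)"
      using p_nonzero D Q_nonzero t e f by (simp add: field_simps)
    then show "second_split_seq Phi i =
        f * (p * D) / e * (1 / p) * (- (1 / f) * (1 / (Q * D))) * Q powi (int d + 2 - 2 * int i) * (1 - Q ^ i) *
          (1 - Q powi (int i - int d - 1))"
      unfolding p2 p3 second_split_seq_Phi[OF i] s2.split_def t2 unfolding t_def[symmetric] e_def[symmetric] f_def[symmetric]
      by simp
  qed (use e f D p_nonzero Q_nonzero in simp_all)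
qed

end

subsection \<open>The projective geometry\<close>

text \<open>Counting supplies \<open>card_common\<close>: for \<open>y = z\<close> the difference is
  the number of covers minus the number of hyperplanes, and for distinct subspaces of equal
  dimension the two counts agree.\<close>

lemma cover_graph_subspaces:
  fixes smul :: "'f::{field,finite} \<Rightarrow> 'v::ab_group_add \<Rightarrow> 'v" and sub :: "'x::finite \<Rightarrow> 'v set"
  assumes "vector_space smul" and "N \<ge> 1" and N: "vector_space.dim smul UNIV = N"
    and bij: "bij_betw sub UNIV {U. module.subspace smul U}" and "\<phi> > 0"
  shows "cover_graph (sub_dim smul sub) (covers smul sub) N CARD('f) \<phi>"
proof -
  interpret vs: vector_space smul by fact
  obtain \<B> where \<B>: "vs.independent \<B>" "UNIV \<subseteq> vs.span \<B>" "card \<B> = N"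
    using vs.basis_exists[of UNIV] N by metis
  \<comment> \<open>\<open>card\<close> is 0 on infinite sets, so \<open>N \<ge> 1\<close> makes the
    basis finite.\<close>
  have "finite \<B>" using \<B>(3) assms(2) by (auto intro: card_ge_0_finite)
  then interpret V: finite_field_vector_space smul \<B>
    using \<B> by unfold_locales auto
  let ?lev = "sub_dim smul sub" and ?cov = "covers smul sub" and ?Q = "of_nat CARD('f) :: complex"
  have subspace: "vs.subspace (sub y)" for y using bij by (auto simp: bij_betw_def)
  have inj: "sub y = sub z \<longleftrightarrow> y = z" for y z using bij by (auto simp: bij_betw_def inj_def)
  have card_sub: "card {x. P (sub x)} = card {U. vs.subspace U \<and> P U}" for P
  proof -
    have "sub ` {x. P (sub x)} = {U \<in> range sub. P U}" by auto
    also have "\<dots> = {U. vs.subspace U \<and> P U}" using bij by (simp add: bij_betw_def)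
    finally have "sub ` {x. P (sub x)} = {U. vs.subspace U \<and> P U}" .
    moreover have "inj_on sub {x. P (sub x)}" using inj by (auto intro: inj_onI)
    ultimately show ?thesis using card_image by metis
  qed
  have q: "CARD('f) \<ge> 2" using V.q_ge_2 by (simp add: V.q_def)
  then have Q1: "?Q - 1 \<noteq> 0" by (metis of_nat_1 of_nat_eq_iff eq_iff_diff_eq_0 numeral_le_one_iff semiring_norm(69))
  have lev_le: "?lev y \<le> N" for y
    using V.dim_subset[of "sub y" UNIV] N by (simp add: sub_dim_def)
  have up: "card {x. ?cov x y \<and> ?cov x z} =
      card {U. vs.subspace U \<and> sub y \<subseteq> U \<and> sub z \<subseteq> U \<and> vs.dim U = Suc (?lev y)}" if "?lev y = ?lev z" for y z
  proof -
    have "{x. ?cov x y \<and> ?cov x z} = {x. sub y \<subseteq> sub x \<and> sub z \<subseteq> sub x \<and> vs.dim (sub x) = Suc (?lev y)}"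
      using that by (auto simp: covers_def sub_dim_def)
    then show ?thesis using card_sub by simp
  qed
  have down: "card {x. ?cov y x \<and> ?cov z x} =
      card {U. vs.subspace U \<and> U \<subseteq> sub y \<and> U \<subseteq> sub z \<and> Suc (vs.dim U) = ?lev y}" if "?lev y = ?lev z" for y z
  proof -
    have "{x. ?cov y x \<and> ?cov z x} = {x. sub x \<subseteq> sub y \<and> sub x \<subseteq> sub z \<and> Suc (vs.dim (sub x)) = ?lev y}"
      using that by (auto simp: covers_def sub_dim_def)
    then show ?thesis using card_sub by simp
  qed
  have complex_card: "of_nat m * (?Q - 1) = ?Q ^ k - 1" if "m * (CARD('f) - 1) = CARD('f) ^ k - 1" for m k
  proof -
    have "of_nat (m * (CARD('f) - 1)) = (of_nat (CARD('f) ^ k - 1) :: complex)" using that by simp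
    then show ?thesis using q by (simp add: of_nat_diff)
  qed
  have "of_nat (card {x. ?cov x y \<and> ?cov x z}) = of_nat (card {x. ?cov y x \<and> ?cov z x}) +
      (if y = z then (?Q ^ (N - ?lev y) - ?Q ^ ?lev y) / (?Q - 1) else 0)" if lev: "?lev y = ?lev z" for y z
  proof (cases "y = z")
    case True
    have "{U. vs.subspace U \<and> sub y \<subseteq> U \<and> sub z \<subseteq> U \<and> vs.dim U = Suc (?lev y)} = V.covers_between (sub y) UNIV"
      using True by (auto simp: V.covers_between_def sub_dim_def)
    then have "card {x. ?cov x y \<and> ?cov x z} * (CARD('f) - 1) = CARD('f) ^ (N - ?lev y) - 1"
      using V.card_covers_between[OF subspace vs.subspace_UNIV, of y] N up[OF lev]
      by (simp add: V.q_def sub_dim_def)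
    note u = complex_card[OF this]
    have "{U. vs.subspace U \<and> U \<subseteq> sub y \<and> U \<subseteq> sub z \<and> Suc (vs.dim U) = ?lev y} = V.hyperplanes (sub y)"
      using True by (auto simp: V.hyperplanes_def sub_dim_def)
    then have "card {x. ?cov y x \<and> ?cov z x} * (CARD('f) - 1) = CARD('f) ^ ?lev y - 1"
      using V.card_hyperplanes[OF subspace, of y] down[OF lev] by (simp add: V.q_def sub_dim_def)
    note d = complex_card[OF this]
    have "of_nat (card {x. ?cov x y \<and> ?cov x z}) = (?Q ^ (N - ?lev y) - 1) / (?Q - 1)"
      using u Q1 by (simp add: field_simps)
    moreover have "of_nat (card {x. ?cov y x \<and> ?cov z x}) = (?Q ^ ?lev y - 1) / (?Q - 1)"
      using d Q1 by (simp add: field_simps)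
    ultimately show ?thesis using True by (simp add: add_divide_distrib[symmetric])
  next
    case False
    then have "card {x. ?cov x y \<and> ?cov x z} = card {x. ?cov y x \<and> ?cov z x}"
      unfolding up[OF lev] down[OF lev]
      using V.card_common_covers_eq[OF subspace subspace, of y z] inj lev by (simp add: sub_dim_def)
    then show ?thesis using False by simp
  qed
  then show ?thesis
    using q assms(5) lev_le by unfold_locales (auto simp: covers_def)
qed

theorem mainTheorem17:
  fixes smul :: "'f::{field,finite} \<Rightarrow> 'v::ab_group_add \<Rightarrow> 'v"
    and sub :: "'x::finite \<Rightarrow> 'v set"
    and N r :: nat
    and \<phi> :: real
    and W :: "(complex ^ 'x) set"
  assumes "vector_space smul"
    and "N \<ge> 1"
    and "vector_space.dim smul UNIV = N"
    and "bij_betw sub UNIV {U. module.subspace smul U}"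
    and "\<phi> > 0"
    and "irreducible_submodule (T_algebra smul sub \<phi>) W"
    and "r = endpoint smul sub N W"
  shows
    "2 * r \<le> N \<and>
     (let q = of_nat CARD('f) :: complex;
          \<Phi> = \<lparr> lspace = W,
                diam = N - 2 * r,
                opr = (\<lambda>w. A_mat smul sub \<phi> *v w),
                idems = (\<lambda>i w. E_mat smul sub N \<phi> (r + i) *v w),
                dual_opr = (\<lambda>w. A_dual smul sub *v w),
                dual_idems = (\<lambda>i w. E_dual smul sub (r + i) *v w) \<rparr>
      in leonard_system \<Phi> \<and>
         dual_q_Krawtchouk_type q \<Phi> (N - 2 * r)
           (of_real \<phi> * q ^ (N - r) / (q - 1))
           (q powi (- int r))
           (- (1 / of_real \<phi>) * q powi (2 * int r - int N - 1))
           ((of_real \<phi> * q ^ (N - r) - q ^ r) / (q - 1))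
           (q powi (- int r)))"
proof -
  interpret cover_graph "sub_dim smul sub" "covers smul sub" N "CARD('f)" \<phi>
    using assms(1-5) by (rule cover_graph_subspaces)
  have A: "A_mat smul sub \<phi> = A"
    unfolding A_mat_def A_def Let_def by simp
  have B: "A_dual smul sub = B"
    unfolding A_dual_def B_def by simp
  have Estar: "E_dual smul sub i = Estar i" for i
    unfolding E_dual_def Estar_def by simp
  have E: "E_mat smul sub N \<phi> i = E i" for i
    unfolding E_mat_def E_def A by simp
  have irr: "irreducible_submodule (gen_algebra {A, B}) W"
    using assms(6) by (simp only: T_algebra_def A B)
  have "r = Min {i \<in> {0..N}. (\<lambda>x. Estar i *v x) ` W \<noteq> {0}}"
    using assms(7) by (simp only: endpoint_def Estar)
  then obtain w0 where w0: "w0 \<in> W" "lowest_weight (sub_dim smul sub) (covers smul sub) N CARD('f) \<phi> r w0"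
    using exists_lowest_weight[of W r] irr unfolding irreducible_submodule_def by blast
  interpret lowest_weight "sub_dim smul sub" "covers smul sub" N "CARD('f)" \<phi> r w0
    by (rule w0(2))
  have W: "W = U" using irr w0(1) by (rule irreducible_eq_U)
  have Phi: "\<lparr> lspace = W, diam = N - 2 * r, opr = (\<lambda>w. A_mat smul sub \<phi> *v w),
      idems = (\<lambda>i w. E_mat smul sub N \<phi> (r + i) *v w), dual_opr = (\<lambda>w. A_dual smul sub *v w),
      dual_idems = (\<lambda>i w. E_dual smul sub (r + i) *v w) \<rparr> = Phi"
    unfolding A B E Estar W d_def[symmetric] Phi_def ..
  show ?thesis
    unfolding Let_def Phi
    using r_and_d(1) leonard_system_Phi irr[unfolded W] dual_q_Krawtchouk_Phi unfolding d_def[symmetric]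
    by blast
qed

end
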